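(* Let $X$ be a real Banach space and $N_X$ a net in $X$. Then $\mathcal{F}(N_X)$ is linearly isomorphic to its countable $\ell_1$-sum $\left(\bigoplus_{\mathbb{N}}\mathcal{F}(N_X)\right)_1$.
   Context: A subset $N$ of a metric space $M$ is a net in $M$ if there exist $\varepsilon,\delta>0$ such that for every $x\in M$ there is $y\in N$ with $d(x,y)\leq\varepsilon$, and $d(x,y)\geq\delta$ for all $x\neq y$ in $N$. Banach spaces carry the norm metric and subsets carry the restricted metric. For a metric space $M$ with a chosen base point $0\in M$, $\mathrm{Lip}_0(M)$ is the Banach space of Lipschitz functions $f:M\to\mathbb{R}$ with $f(0)=0$, normed by the best Lipschitz constant. The Lipschitz-free space is $\mathcal{F}(M)=\overline{\mathrm{span}}\{\delta(x):x\in M\}\subset \mathrm{Lip}_0(M)^*$, where $\delta(x)(f)=f(x)$; its isometry class does not depend on the base point. $\left(\bigoplus_{\mathbb{N}}Y\right)_1$ denotes the $\ell_1$-sum of countably infinitely many copies of a Banach space $Y$. *)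

theory Defs
  imports "HOL-Analysis.Analysis" "HOL-Library.Function_Algebras"
begin

instantiation "fun" :: (type, real_vector) real_vector
begin

definition scaleR_fun :: "real \<Rightarrow> ('a \<Rightarrow> 'b) \<Rightarrow> 'a \<Rightarrow> 'b" where
  "scaleR_fun c f = (\<lambda>x. c *\<^sub>R f x)"

instance
  by standard (auto simp: scaleR_fun_def fun_eq_iff scaleR_add_right scaleR_add_left)

end

text \<open>
  The normed spaces below depend on a subset of a type, so they cannot be types themselves.
  A normed space is given by a linear subspace of an ambient real vector space (whose
  operations it inherits) and a norm that is only meaningful on that subspace.
\<close>

record 'v nspace =
  pts :: "'v set"
  nrm :: "'v \<Rightarrow> real"

definition bounded_linear_map ::
    "'v::real_vector nspace \<Rightarrow> 'w::real_vector nspace \<Rightarrow> ('v \<Rightarrow> 'w) \<Rightarrow> bool" where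
  "bounded_linear_map V W T \<longleftrightarrow>
     (\<forall>u\<in>pts V. T u \<in> pts W) \<and>
     (\<forall>u\<in>pts V. \<forall>v\<in>pts V. T (u + v) = T u + T v) \<and>
     (\<forall>c. \<forall>u\<in>pts V. T (c *\<^sub>R u) = c *\<^sub>R T u) \<and>
     (\<exists>K. \<forall>u\<in>pts V. nrm W (T u) \<le> K * nrm V u)"

definition linearly_isomorphic ::
    "'v::real_vector nspace \<Rightarrow> 'w::real_vector nspace \<Rightarrow> bool" where
  "linearly_isomorphic V W \<longleftrightarrow>
     (\<exists>T. bij_betw T (pts V) (pts W) \<and> bounded_linear_map V W T \<and>
          bounded_linear_map W V (inv_into (pts V) T))"

text \<open>Functionals on \<open>V\<close> are extended by \<open>0\<close> outside \<open>V\<close>, so that equality of functionals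
  is equality on \<open>V\<close>.\<close>

definition dual :: "'v::real_vector nspace \<Rightarrow> ('v \<Rightarrow> real) nspace" where
  "dual V =
     \<lparr> pts = {\<phi>. bounded_linear_map V \<lparr> pts = UNIV, nrm = abs \<rparr> \<phi> \<and> (\<forall>v. v \<notin> pts V \<longrightarrow> \<phi> v = 0)},
       nrm = (\<lambda>\<phi>. Sup {\<bar>\<phi> v\<bar> |v. v \<in> pts V \<and> nrm V v \<le> 1}) \<rparr>"

definition closed_span :: "'v::real_vector nspace \<Rightarrow> 'v set \<Rightarrow> 'v nspace" where
  "closed_span V A =
     \<lparr> pts = {v \<in> pts V. \<forall>e>0. \<exists>w\<in>span A. nrm V (v - w) < e},
       nrm = nrm V \<rparr>"

definition l1_sum :: "'v::real_vector nspace \<Rightarrow> (nat \<Rightarrow> 'v) nspace" where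
  "l1_sum V =
     \<lparr> pts = {s. (\<forall>n. s n \<in> pts V) \<and> summable (\<lambda>n. nrm V (s n))},
       nrm = (\<lambda>s. \<Sum>n. nrm V (s n)) \<rparr>"

text \<open>A function on the metric space \<open>M\<close> is likewise represented by its extension by \<open>0\<close>
  outside \<open>M\<close>; the base point is \<open>p\<close>.\<close>

definition Lip0 :: "'a::metric_space set \<Rightarrow> 'a \<Rightarrow> ('a \<Rightarrow> real) nspace" where
  "Lip0 M p =
     \<lparr> pts = {f. (\<exists>L. L-lipschitz_on M f) \<and> f p = 0 \<and> (\<forall>x. x \<notin> M \<longrightarrow> f x = 0)},
       nrm = (\<lambda>f. Inf {L. L-lipschitz_on M f}) \<rparr>"

definition evaluation :: "'a::metric_space set \<Rightarrow> 'a \<Rightarrow> 'a \<Rightarrow> ('a \<Rightarrow> real) \<Rightarrow> real" where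
  "evaluation M p x = (\<lambda>f. if f \<in> pts (Lip0 M p) then f x else 0)"

definition lipschitz_free :: "'a::metric_space set \<Rightarrow> 'a \<Rightarrow> (('a \<Rightarrow> real) \<Rightarrow> real) nspace" where
  "lipschitz_free M p = closed_span (dual (Lip0 M p)) (evaluation M p ` M)"

definition net_in :: "'a::metric_space set \<Rightarrow> 'a set \<Rightarrow> bool" where
  "net_in M N \<longleftrightarrow> N \<subseteq> M \<and>
     (\<exists>\<epsilon>>0. \<exists>\<delta>>0. (\<forall>x\<in>M. \<exists>y\<in>N. dist x y \<le> \<epsilon>) \<and>
                  (\<forall>x\<in>N. \<forall>y\<in>N. x \<noteq> y \<longrightarrow> \<delta> \<le> dist x y))"

end

theory Submission
  imports Defs
begin

text \<open>
  Write \<open>F\<close> for the free space of the net. By Pelczynski's decomposition method it suffices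
  that the \<open>\<ell>\<^sub>1\<close>-sum of \<open>F\<close> is complemented in \<open>F\<close>. Following Kalton, a dyadic partition of
  unity around the base point splits \<open>F\<close> into pieces supported on bounded annuli. Since \<open>N\<close> is a
  net in a normed space, every ball of \<open>N\<close> has a dilated copy around any given point of the space:
  dilate, translate, and round to a nearby point of the net. Undoing this with a Lipschitz cutoff
  gives a Lipschitz retraction, with constants that depend neither on the ball nor on its new
  centre. Placing the annuli of countably many copies of \<open>F\<close> in pairwise disjoint balls embeds the
  \<open>\<ell>\<^sub>1\<close>-sum, and the retractions, glued together, give the projection. All
  operators are adjoints of operators on Lipschitz functions.
\<close>

text \<open>Only bounded pieces can be copied: a ball of \<open>N\<close> fits, dilated, into any
  large enough ball, and infinitely many of these fit side by side. A net has no exact dilations or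
  translations; rounding costs a fixed error, which between points at least a fixed distance apart
  is a Lipschitz error. On Lipschitz functions, coordinate \<open>n\<close> of the projection is the
  adjoint of \<open>A n\<close>, composition with \<open>q n\<close>, the union of the retractions
  of those copies that belong to summand \<open>n\<close>. The embedding of summand \<open>n\<close>
  is the adjoint of \<open>B n\<close>, which adds up the weights \<open>dyadic p k\<close> times
  the function read off in copy \<open>(n, k)\<close>. Retraction after dilation is the identity on
  each annulus and the weights add up to 1, so \<open>B n (A m f)\<close> is \<open>f\<close> if
  \<open>n = m\<close> and 0 otherwise. By duality, boundedness of the map into the
  \<open>\<ell>\<^sub>1\<close>-sum is a uniform bound for finite sums of \<open>A n (f n)\<close>
  with \<open>f n\<close> in the unit ball. It holds because the pieces of these functions vanish
  outside pairwise disjoint sets: gluing them costs a factor 2, however close the sets are.\<close>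

section \<open>Bounded linear maps between seminormed spaces\<close>

lemma bounded_linear_mapI:
  assumes "\<And>u. u \<in> pts V \<Longrightarrow> T u \<in> pts W"
    and "\<And>u v. u \<in> pts V \<Longrightarrow> v \<in> pts V \<Longrightarrow> T (u + v) = T u + T v"
    and "\<And>c u. u \<in> pts V \<Longrightarrow> T (c *\<^sub>R u) = c *\<^sub>R T u"
    and "\<And>u. u \<in> pts V \<Longrightarrow> nrm W (T u) \<le> K * nrm V u"
  shows "bounded_linear_map V W T"
  using assms unfolding bounded_linear_map_def by blast

lemma bounded_linear_mapD:
  assumes "bounded_linear_map V W T"
  shows "u \<in> pts V \<Longrightarrow> T u \<in> pts W"
    and "u \<in> pts V \<Longrightarrow> v \<in> pts V \<Longrightarrow> T (u + v) = T u + T v"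
    and "u \<in> pts V \<Longrightarrow> T (c *\<^sub>R u) = c *\<^sub>R T u"
  using assms unfolding bounded_linear_map_def by blast+

text \<open>Records of type \<open>nspace\<close> carry no laws, so each of \<open>l1_sum\<close>,
  \<open>dual\<close>, \<open>closed_span\<close> and \<open>Lip0\<close> gets its own proof of
  these.\<close>

locale seminormed_space =
  fixes V :: "'v::real_vector nspace"
  assumes subspace_pts: "subspace (pts V)"
    and nrm_nonneg: "u \<in> pts V \<Longrightarrow> 0 \<le> nrm V u"
    and nrm_triangle: "u \<in> pts V \<Longrightarrow> v \<in> pts V \<Longrightarrow> nrm V (u + v) \<le> nrm V u + nrm V v"
    and nrm_scaleR: "u \<in> pts V \<Longrightarrow> nrm V (c *\<^sub>R u) = \<bar>c\<bar> * nrm V u"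
begin

lemmas pts_closed =
  subspace_0[OF subspace_pts] subspace_add[OF subspace_pts] subspace_scale[OF subspace_pts]
  subspace_neg[OF subspace_pts] subspace_diff[OF subspace_pts] subspace_sum[OF subspace_pts]

lemma nrm_zero: "nrm V 0 = 0"
  using nrm_scaleR[of 0 0] pts_closed(1) by simp

lemma nrm_diff_triangle:
  assumes "u \<in> pts V" "v \<in> pts V" "w \<in> pts V"
  shows "nrm V (u - w) \<le> nrm V (u - v) + nrm V (v - w)"
  using nrm_triangle[of "u - v" "v - w"] pts_closed(5) assms by simp

text \<open>The constant in \<open>bounded_linear_map\<close> may have any sign; a positive one can
  be multiplied into inequalities and divided by.\<close>

lemma bounded_map_pos:
  assumes "bounded_linear_map V W T"
  obtains K where "K > 0" "\<And>u. u \<in> pts V \<Longrightarrow> nrm W (T u) \<le> K * nrm V u"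
proof -
  obtain K where K: "\<And>u. u \<in> pts V \<Longrightarrow> nrm W (T u) \<le> K * nrm V u"
    using assms unfolding bounded_linear_map_def by blast
  have "nrm W (T u) \<le> (\<bar>K\<bar> + 1) * nrm V u" if "u \<in> pts V" for u
    using K[OF that] mult_right_mono[of K "\<bar>K\<bar> + 1" "nrm V u"] nrm_nonneg[OF that] by linarith
  then show thesis using that[of "\<bar>K\<bar> + 1"] by simp
qed

lemma bounded_map_diff:
  assumes "bounded_linear_map V W T" "u \<in> pts V" "v \<in> pts V"
  shows "T (u - v) = T u - T v"
  using bounded_linear_mapD(2)[OF assms(1), of "u - v" v] pts_closed(5) assms by simp

lemma bounded_map_zero:
  assumes "bounded_linear_map V W T" shows "T 0 = 0"
  using bounded_map_diff[OF assms, of 0 0] pts_closed(1) by simp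

lemma bounded_linear_map_id: "bounded_linear_map V V (\<lambda>u. u)"
  by (rule bounded_linear_mapI[where K = 1]) auto

end

text \<open>Serves the \<open>inv_into\<close> in \<open>linearly_isomorphic\<close>, which agrees
  with an explicit inverse only on the points of the space.\<close>

lemma bounded_linear_map_cong:
  assumes "seminormed_space V" "bounded_linear_map V W T" "\<And>u. u \<in> pts V \<Longrightarrow> T' u = T u"
  shows "bounded_linear_map V W T'"
proof -
  interpret seminormed_space V by fact
  obtain K where K: "\<And>u. u \<in> pts V \<Longrightarrow> nrm W (T u) \<le> K * nrm V u"
    using bounded_map_pos[OF assms(2)] by blast
  show ?thesis
    by (rule bounded_linear_mapI[where K = K])
      (use assms(3) K bounded_linear_mapD[OF assms(2)] pts_closed in auto)
qed

lemma bounded_linear_map_compose: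
  assumes "seminormed_space V" "seminormed_space W"
    and T: "bounded_linear_map V W T" and S: "bounded_linear_map W Z S"
  shows "bounded_linear_map V Z (\<lambda>u. S (T u))"
proof -
  interpret V: seminormed_space V by fact
  interpret W: seminormed_space W by fact
  obtain K where K: "K > 0" "\<And>u. u \<in> pts V \<Longrightarrow> nrm W (T u) \<le> K * nrm V u"
    using V.bounded_map_pos[OF T] by blast
  obtain L where L: "L > 0" "\<And>u. u \<in> pts W \<Longrightarrow> nrm Z (S u) \<le> L * nrm W u"
    using W.bounded_map_pos[OF S] by blast
  have "nrm Z (S (T u)) \<le> L * K * nrm V u" if "u \<in> pts V" for u
  proof -
    have "nrm Z (S (T u)) \<le> L * nrm W (T u)"
      using L(2) bounded_linear_mapD(1)[OF T that] by simp
    also have "\<dots> \<le> L * (K * nrm V u)"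
      using K(2)[OF that] L(1) by simp
    finally show ?thesis by (simp add: mult.assoc)
  qed
  then show ?thesis
    by (intro bounded_linear_mapI[where K = "L * K"])
      (auto simp: bounded_linear_mapD[OF T] bounded_linear_mapD[OF S])
qed

lemma bounded_linear_map_add:
  assumes "seminormed_space V" "seminormed_space W"
    and T: "bounded_linear_map V W T" and S: "bounded_linear_map V W S"
  shows "bounded_linear_map V W (\<lambda>u. T u + S u)"
proof -
  interpret V: seminormed_space V by fact
  interpret W: seminormed_space W by fact
  obtain K where K: "\<And>u. u \<in> pts V \<Longrightarrow> nrm W (T u) \<le> K * nrm V u"
    using V.bounded_map_pos[OF T] by blast
  obtain L where L: "\<And>u. u \<in> pts V \<Longrightarrow> nrm W (S u) \<le> L * nrm V u"
    using V.bounded_map_pos[OF S] by blast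
  have "nrm W (T u + S u) \<le> (K + L) * nrm V u" if "u \<in> pts V" for u
    using W.nrm_triangle[of "T u" "S u"] K[OF that] L[OF that]
      bounded_linear_mapD(1)[OF T that] bounded_linear_mapD(1)[OF S that]
    by (simp add: distrib_right)
  then show ?thesis
    by (intro bounded_linear_mapI[where K = "K + L"])
      (auto simp: bounded_linear_mapD[OF T] bounded_linear_mapD[OF S] W.pts_closed scaleR_add_right)
qed

lemma bounded_linear_map_diff:
  assumes "seminormed_space V" "seminormed_space W"
    and T: "bounded_linear_map V W T" and S: "bounded_linear_map V W S"
  shows "bounded_linear_map V W (\<lambda>u. T u - S u)"
proof -
  interpret V: seminormed_space V by fact
  interpret W: seminormed_space W by fact
  have "bounded_linear_map W W (\<lambda>u. - u)"
    by (rule bounded_linear_mapI[where K = 1])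
      (use W.pts_closed W.nrm_scaleR[of _ "-1"] in auto)
  from bounded_linear_map_add[OF assms(1,2) T bounded_linear_map_compose[OF assms(1,2) S this]]
  show ?thesis by simp
qed

lemma linearly_isomorphicI:
  assumes "seminormed_space V" "seminormed_space W"
    and T: "bounded_linear_map V W T" and S: "bounded_linear_map W V S"
    and ST: "\<And>u. u \<in> pts V \<Longrightarrow> S (T u) = u" and TS: "\<And>w. w \<in> pts W \<Longrightarrow> T (S w) = w"
  shows "linearly_isomorphic V W"
proof -
  have bij: "bij_betw T (pts V) (pts W)"
    by (rule bij_betw_byWitness[where f' = S])
      (use ST TS bounded_linear_mapD(1)[OF T] bounded_linear_mapD(1)[OF S] in auto)
  have "inv_into (pts V) T w = S w" if "w \<in> pts W" for w
    using inv_into_f_f[OF bij_betw_imp_inj_on[OF bij], of "S w"] that TS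
      bounded_linear_mapD(1)[OF S] by simp
  then have "bounded_linear_map W V (inv_into (pts V) T)"
    using bounded_linear_map_cong[OF assms(2) S] by blast
  with bij T show ?thesis
    unfolding linearly_isomorphic_def by blast
qed

section \<open>\<open>\<ell>\<^sub>1\<close>-sums\<close>

lemma pts_l1_sum:
  "s \<in> pts (l1_sum V) \<longleftrightarrow> (\<forall>n. s n \<in> pts V) \<and> summable (\<lambda>n. nrm V (s n))"
  by (simp add: l1_sum_def)

lemma nrm_l1_sum: "nrm (l1_sum V) s = (\<Sum>n. nrm V (s n))"
  by (simp add: l1_sum_def)

lemma seminormed_l1_sum:
  assumes "seminormed_space V" shows "seminormed_space (l1_sum V)"
proof -
  interpret seminormed_space V by fact
  have add: "summable (\<lambda>n. nrm V (s n + t n))"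
    if "s \<in> pts (l1_sum V)" "t \<in> pts (l1_sum V)" for s t
    by (rule summable_comparison_test'[where g = "\<lambda>n. nrm V (s n) + nrm V (t n)" and N = 0])
      (use that in \<open>auto simp: pts_l1_sum intro!: summable_add nrm_triangle simp: nrm_nonneg pts_closed\<close>)
  show ?thesis
  proof
    show "subspace (pts (l1_sum V))"
      using add by (auto simp: subspace_def pts_l1_sum pts_closed nrm_zero nrm_scaleR scaleR_fun_def
          intro: summable_mult)
  next
    fix s t assume "s \<in> pts (l1_sum V)" "t \<in> pts (l1_sum V)"
    with add[OF this] show "nrm (l1_sum V) (s + t) \<le> nrm (l1_sum V) s + nrm (l1_sum V) t"
      unfolding nrm_l1_sum
      by (subst suminf_add) (auto simp: pts_l1_sum intro!: suminf_le nrm_triangle summable_add)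
  qed (auto simp: nrm_l1_sum pts_l1_sum nrm_scaleR scaleR_fun_def suminf_mult
      intro!: suminf_nonneg nrm_nonneg)
qed

lemma bounded_linear_map_l1_map:
  assumes "seminormed_space V" "seminormed_space W" and T: "bounded_linear_map V W T"
  shows "bounded_linear_map (l1_sum V) (l1_sum W) (\<lambda>s n. T (s n))"
proof -
  interpret V: seminormed_space V by fact
  interpret W: seminormed_space W by fact
  obtain K where K: "\<And>u. u \<in> pts V \<Longrightarrow> nrm W (T u) \<le> K * nrm V u"
    using V.bounded_map_pos[OF T] by blast
  note D = bounded_linear_mapD[OF T]
  have sm: "summable (\<lambda>n. nrm W (T (s n)))" if "s \<in> pts (l1_sum V)" for s
    by (rule summable_comparison_test'[where g = "\<lambda>n. K * nrm V (s n)" and N = 0])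
      (use that K D W.nrm_nonneg in \<open>auto simp: pts_l1_sum intro!: summable_mult\<close>)
  show ?thesis
  proof (rule bounded_linear_mapI[where K = K])
    fix s assume s: "s \<in> pts (l1_sum V)"
    then show "nrm (l1_sum W) (\<lambda>n. T (s n)) \<le> K * nrm (l1_sum V) s"
      using sm[OF s] K unfolding nrm_l1_sum pts_l1_sum
      by (subst suminf_mult[symmetric]) (auto intro!: suminf_le summable_mult)
  qed (use sm D in \<open>auto simp: pts_l1_sum scaleR_fun_def\<close>)
qed

text \<open>Injections and projections for the splitting of \<open>l1_sum V\<close> into coordinate
  0 and the remaining ones. The shifts in the decomposition method are composed of them.\<close>

lemma bounded_linear_map_l1_cons:
  assumes "seminormed_space V"
  shows "bounded_linear_map V (l1_sum V) (\<lambda>u. case_nat u (\<lambda>_. 0))"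
    and "bounded_linear_map (l1_sum V) (l1_sum V) (\<lambda>s. case_nat 0 s)"
    and "bounded_linear_map (l1_sum V) V (\<lambda>s. s 0)"
    and "bounded_linear_map (l1_sum V) (l1_sum V) (\<lambda>s n. s (Suc n))"
proof -
  interpret seminormed_space V by fact
  have split: "summable (\<lambda>n. nrm V (s n)) \<longleftrightarrow> summable (\<lambda>n. nrm V (s (Suc n)))" for s
    using summable_Suc_iff[of "\<lambda>n. nrm V (s n)"] by simp
  have head: "(\<Sum>n. nrm V (s n)) = nrm V (s 0) + (\<Sum>n. nrm V (s (Suc n)))"
    if "summable (\<lambda>n. nrm V (s (Suc n)))" for s
    using suminf_split_head[of "\<lambda>n. nrm V (s n)"] that split[of s] by simp
  have nonneg: "0 \<le> (\<Sum>n. nrm V (s (Suc n)))" if "s \<in> pts (l1_sum V)" for s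
    using that split[of s] by (auto simp: pts_l1_sum intro!: suminf_nonneg nrm_nonneg)
  show "bounded_linear_map V (l1_sum V) (\<lambda>u. case_nat u (\<lambda>_. 0))"
    by (rule bounded_linear_mapI[where K = 1])
      (auto simp: pts_l1_sum nrm_l1_sum split[of "case_nat _ _"] head[of "case_nat _ _"] nrm_zero
        pts_closed scaleR_fun_def fun_eq_iff split: nat.split)
  show "bounded_linear_map (l1_sum V) (l1_sum V) (\<lambda>s. case_nat 0 s)"
    by (rule bounded_linear_mapI[where K = 1])
      (auto simp: pts_l1_sum nrm_l1_sum split[of "case_nat _ _"] head[of "case_nat _ _"] nrm_zero
        pts_closed scaleR_fun_def fun_eq_iff split: nat.split)
  show "bounded_linear_map (l1_sum V) V (\<lambda>s. s 0)"
    by (rule bounded_linear_mapI[where K = 1])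
      (use nonneg in \<open>auto simp: pts_l1_sum nrm_l1_sum head[OF iffD1[OF split]] scaleR_fun_def\<close>)
  show "bounded_linear_map (l1_sum V) (l1_sum V) (\<lambda>s n. s (Suc n))"
    by (rule bounded_linear_mapI[where K = 1])
      (auto simp: pts_l1_sum nrm_l1_sum split[symmetric] head[OF iffD1[OF split]] scaleR_fun_def nrm_nonneg)
qed

text \<open>
  Pelczynski's decomposition method. With \<open>P = J R\<close> and \<open>Q = 1 - P\<close>, the space \<open>V\<close> is
  the sum of the range of \<open>P\<close>, a copy of its \<open>\<ell>\<^sub>1\<close>-sum, and the range of \<open>Q\<close>; the isomorphism
  moves the \<open>Q\<close>-components one place to the right to make room for \<open>Q u\<close>.
\<close>
theorem linearly_isomorphic_l1_sum_if_complemented: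
  assumes V: "seminormed_space V"
    and J: "bounded_linear_map (l1_sum V) V J" and R: "bounded_linear_map V (l1_sum V) R"
    and RJ: "\<And>s. s \<in> pts (l1_sum V) \<Longrightarrow> R (J s) = s"
  shows "linearly_isomorphic V (l1_sum V)"
proof -
  interpret V: seminormed_space V by fact
  note W = seminormed_l1_sum[OF V]
  interpret W: seminormed_space "l1_sum V" by (rule W)
  define P where "P = (\<lambda>u. J (R u))"
  define Q where "Q = (\<lambda>u. u - P u)"
  have P: "bounded_linear_map V V P"
    unfolding P_def by (rule bounded_linear_map_compose[OF V W R J])
  have Q: "bounded_linear_map V V Q"
    unfolding Q_def by (rule bounded_linear_map_diff[OF V V V.bounded_linear_map_id P])
  note cons = bounded_linear_map_l1_cons[OF V]
  note lP = bounded_linear_map_l1_map[OF V V P] and lQ = bounded_linear_map_l1_map[OF V V Q]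
  define T where "T = (\<lambda>u. case_nat (Q u) (\<lambda>_. 0) + case_nat 0 (\<lambda>n. Q (R u n)) + (\<lambda>n. P (R u n)))"
  \<comment> \<open>The inverse reads the \<open>Q\<close>-parts one place further right than the
    \<open>P\<close>-parts, which gives \<open>s (T u) = R u\<close>; the \<open>Q\<close>-part of
    coordinate 0 is left over and returns \<open>Q u\<close>.\<close>
  define s where "s = (\<lambda>t. (\<lambda>n. Q (t (Suc n))) + (\<lambda>n. P (t n)))"
  define S where "S = (\<lambda>t. J (s t) + Q (t 0))"
  have T: "bounded_linear_map V (l1_sum V) T"
    unfolding T_def
    by (intro bounded_linear_map_add[OF V W])
      (rule bounded_linear_map_compose[OF V V Q cons(1)]
        bounded_linear_map_compose[OF V W bounded_linear_map_compose[OF V W R lQ] cons(2)]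
        bounded_linear_map_compose[OF V W R lP])+
  have s: "bounded_linear_map (l1_sum V) (l1_sum V) s"
    unfolding s_def
    by (intro bounded_linear_map_add[OF W W] lP bounded_linear_map_compose[OF W W cons(4) lQ])
  have S: "bounded_linear_map (l1_sum V) V S"
    unfolding S_def
    by (intro bounded_linear_map_add[OF W V] bounded_linear_map_compose[OF W W s J]
        bounded_linear_map_compose[OF W V cons(3) Q])
  note mem = bounded_linear_mapD(1)[OF P] bounded_linear_mapD(1)[OF Q] bounded_linear_mapD(1)[OF R]
    bounded_linear_mapD(1)[OF J] bounded_linear_mapD(1)[OF s] bounded_linear_mapD(1)[OF T]
    V.pts_closed W.pts_closed
  note PQ_add = bounded_linear_mapD(2)[OF P] bounded_linear_mapD(2)[OF Q]
  have memn: "t n \<in> pts V" if "t \<in> pts (l1_sum V)" for t n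
    using that by (simp add: pts_l1_sum)
  have PP: "P (P u) = P u" if "u \<in> pts V" for u
    unfolding P_def using RJ mem(3) that by simp
  have QP: "Q (P u) = 0" if "u \<in> pts V" for u
    unfolding Q_def using PP that by simp
  have RQ: "R (Q u) = 0" if "u \<in> pts V" for u
    using V.bounded_map_diff[OF R that mem(1)[OF that]] RJ[OF mem(3)[OF that]]
    by (simp add: Q_def P_def)
  have PQ: "P (Q u) = 0" if "u \<in> pts V" for u
    unfolding P_def using RQ[OF that] W.bounded_map_zero[OF J] by simp
  have QQ: "Q (Q u) = Q u" if "u \<in> pts V" for u
    using PQ[OF that] fun_cong[OF Q_def, of "Q u"] by simp
  have QJ: "Q (J t) = 0" if "t \<in> pts (l1_sum V)" for t
    unfolding Q_def P_def using RJ[OF that] by simp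
  have Q_plus_P: "Q u + P u = u" for u
    by (simp add: Q_def)
  have T0: "T u 0 = Q u + P (R u 0)" and TSuc: "T u (Suc n) = Q (R u n) + P (R u (Suc n))" for u n
    by (simp_all add: T_def)
  have sn: "s t n = Q (t (Suc n)) + P (t n)" for t n
    by (simp add: s_def)
  show ?thesis
  proof (rule linearly_isomorphicI[OF V W T S])
    fix u assume u: "u \<in> pts V"
    note Ru = memn[OF mem(3)[OF u]]
    have "s (T u) n = R u n" for n
      by (cases n) (simp_all add: sn T0 TSuc PQ_add mem Ru u PP PQ QP QQ Q_plus_P)
    then have "s (T u) = R u" by blast
    moreover have "Q (T u 0) = Q u"
      by (simp add: T0 PQ_add mem Ru u QP QQ)
    ultimately show "S (T u) = u"
      using Q_plus_P[of u] by (simp add: S_def P_def add.commute)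
  next
    fix t assume t: "t \<in> pts (l1_sum V)"
    note tn = memn[OF t]
    have R_St: "R (S t) = s t"
      using bounded_linear_mapD(2)[OF R, of "J (s t)" "Q (t 0)"] RJ RQ
      by (simp add: S_def mem t tn)
    have Q_St: "Q (S t) = Q (t 0)"
      by (simp add: S_def mem t tn PQ_add QJ QQ)
    have "T (S t) n = t n" for n
      by (cases n) (simp_all add: sn T0 TSuc PQ_add mem tn PP PQ QP QQ Q_plus_P R_St Q_St)
    then show "T (S t) = t" by blast
  qed
qed

section \<open>Duals and closed spans\<close>

lemma pts_dual:
  "\<phi> \<in> pts (dual V) \<longleftrightarrow>
    bounded_linear_map V \<lparr> pts = UNIV, nrm = abs \<rparr> \<phi> \<and> (\<forall>v. v \<notin> pts V \<longrightarrow> \<phi> v = 0)"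
  by (simp add: dual_def)

lemma nrm_dual: "nrm (dual V) \<phi> = Sup {\<bar>\<phi> v\<bar> |v. v \<in> pts V \<and> nrm V v \<le> 1}"
  by (simp add: dual_def)

lemma dualD:
  assumes "\<phi> \<in> pts (dual V)"
  shows "u \<in> pts V \<Longrightarrow> v \<in> pts V \<Longrightarrow> \<phi> (u + v) = \<phi> u + \<phi> v"
    and "u \<in> pts V \<Longrightarrow> \<phi> (c *\<^sub>R u) = c * \<phi> u"
    and "u \<notin> pts V \<Longrightarrow> \<phi> u = 0"
  using assms unfolding pts_dual bounded_linear_map_def by auto

lemma dualI:
  assumes "\<And>u v. u \<in> pts V \<Longrightarrow> v \<in> pts V \<Longrightarrow> \<phi> (u + v) = \<phi> u + \<phi> v"
    and "\<And>c u. u \<in> pts V \<Longrightarrow> \<phi> (c *\<^sub>R u) = c * \<phi> u"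
    and "\<And>u. u \<in> pts V \<Longrightarrow> \<bar>\<phi> u\<bar> \<le> K * nrm V u"
    and "\<And>u. u \<notin> pts V \<Longrightarrow> \<phi> u = 0"
  shows "\<phi> \<in> pts (dual V)"
  using assms unfolding pts_dual by (auto intro: bounded_linear_mapI[where K = K])

context seminormed_space
begin

lemma bounded_map_sum:
  assumes "bounded_linear_map V W T" "\<And>i. i \<in> I \<Longrightarrow> f i \<in> pts V"
  shows "T (sum f I) = (\<Sum>i\<in>I. T (f i))"
  using assms(2)
proof (induction I rule: infinite_finite_induct)
  case (insert i I)
  then have "T (f i + sum f I) = T (f i) + T (sum f I)"
    using bounded_linear_mapD(2)[OF assms(1)] pts_closed(6)[of I f] by simp
  with insert show ?case by simp
qed (simp_all add: bounded_map_zero[OF assms(1)])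

lemma dual_nrm_le:
  assumes "\<And>v. v \<in> pts V \<Longrightarrow> nrm V v \<le> 1 \<Longrightarrow> \<bar>\<phi> v\<bar> \<le> K"
  shows "nrm (dual V) \<phi> \<le> K"
  unfolding nrm_dual
proof (rule cSup_least)
  show "{\<bar>\<phi> v\<bar> |v. v \<in> pts V \<and> nrm V v \<le> 1} \<noteq> {}"
    using pts_closed(1) nrm_zero by force
qed (use assms in auto)

lemma dual_ball_le:
  assumes "\<phi> \<in> pts (dual V)" "v \<in> pts V" "nrm V v \<le> 1"
  shows "\<bar>\<phi> v\<bar> \<le> nrm (dual V) \<phi>"
proof -
  obtain K where K: "K > 0" "\<And>u. u \<in> pts V \<Longrightarrow> \<bar>\<phi> u\<bar> \<le> K * nrm V u"
    using bounded_map_pos assms(1) unfolding pts_dual by (metis nspace.select_convs(2))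
  have "\<bar>\<phi> u\<bar> \<le> K" if "u \<in> pts V" "nrm V u \<le> 1" for u
    using K(2)[OF that(1)] mult_left_mono[OF that(2), of K] K(1) by linarith
  then have "bdd_above {\<bar>\<phi> v\<bar> |v. v \<in> pts V \<and> nrm V v \<le> 1}"
    by (auto simp: bdd_above_def)
  then show ?thesis
    unfolding nrm_dual using assms by (intro cSup_upper) auto
qed

lemma dual_apply_le:
  assumes "\<phi> \<in> pts (dual V)" "v \<in> pts V"
  shows "\<bar>\<phi> v\<bar> \<le> nrm (dual V) \<phi> * nrm V v"
proof (cases "nrm V v = 0")
  case True
  \<comment> \<open>A seminorm may vanish at \<open>v\<close> without \<open>v\<close> being 0. Then
    \<open>v\<close> cannot be normalised, but any bound for \<phi> forces
    \<open>\<phi> v = 0\<close>.\<close>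
  obtain K where K: "K > 0" "\<And>u. u \<in> pts V \<Longrightarrow> \<bar>\<phi> u\<bar> \<le> K * nrm V u"
    using bounded_map_pos assms(1) unfolding pts_dual by (metis nspace.select_convs(2))
  from K(2)[OF assms(2)] True show ?thesis by simp
next
  case False
  then have pos: "nrm V v > 0"
    using nrm_nonneg[OF assms(2)] by simp
  have "\<bar>\<phi> ((1 / nrm V v) *\<^sub>R v)\<bar> \<le> nrm (dual V) \<phi>"
    using pos assms by (intro dual_ball_le) (auto simp: pts_closed nrm_scaleR)
  then show ?thesis
    using pos assms by (simp add: dualD(2) abs_mult field_simps)
qed

text \<open>The unit ball is symmetric, so the supremum is approached by the values of \<phi>
  themselves, without absolute values. Such values can be added up, which turns a sum of dual norms
  into one value of a functional.\<close>

lemma dual_norming: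
  assumes "\<phi> \<in> pts (dual V)" "e > 0"
  shows "\<exists>v\<in>pts V. nrm V v \<le> 1 \<and> nrm (dual V) \<phi> - e < \<phi> v"
proof (rule ccontr)
  assume *: "\<not> ?thesis"
  have le: "\<phi> v \<le> nrm (dual V) \<phi> - e" if "v \<in> pts V" "nrm V v \<le> 1" for v
    using * that by force
  have "\<bar>\<phi> v\<bar> \<le> nrm (dual V) \<phi> - e" if "v \<in> pts V" "nrm V v \<le> 1" for v
    using le[of v] le[of "- v"] that dualD(2)[OF assms(1), of v "-1"] nrm_scaleR[of v "-1"]
      pts_closed(4) by simp
  from dual_nrm_le[of \<phi>, OF this] assms(2) show False by simp
qed

lemma seminormed_dual: "seminormed_space (dual V)"
proof
  show sub: "subspace (pts (dual V))"
  proof (rule subspaceI)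
    show "0 \<in> pts (dual V)" by (rule dualI[where K = 0]) auto
  next
    fix \<phi> \<psi> assume \<phi>: "\<phi> \<in> pts (dual V)" and \<psi>: "\<psi> \<in> pts (dual V)"
    show "\<phi> + \<psi> \<in> pts (dual V)"
    proof (rule dualI)
      fix u assume "u \<in> pts V"
      then show "\<bar>(\<phi> + \<psi>) u\<bar> \<le> (nrm (dual V) \<phi> + nrm (dual V) \<psi>) * nrm V u"
        using dual_apply_le[OF \<phi>, of u] dual_apply_le[OF \<psi>, of u] by (simp add: distrib_right)
    qed (auto simp: dualD[OF \<phi>] dualD[OF \<psi>] distrib_left)
  next
    fix c :: real and \<phi> assume \<phi>: "\<phi> \<in> pts (dual V)"
    show "c *\<^sub>R \<phi> \<in> pts (dual V)"
    proof (rule dualI)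
      fix u assume "u \<in> pts V"
      then show "\<bar>(c *\<^sub>R \<phi>) u\<bar> \<le> (\<bar>c\<bar> * nrm (dual V) \<phi>) * nrm V u"
        using mult_left_mono[OF dual_apply_le[OF \<phi>, of u], of "\<bar>c\<bar>"]
        by (simp add: scaleR_fun_def abs_mult mult.assoc)
    qed (auto simp: scaleR_fun_def dualD[OF \<phi>] distrib_left)
  qed
  show nonneg: "0 \<le> nrm (dual V) \<phi>" if "\<phi> \<in> pts (dual V)" for \<phi>
    using dual_ball_le[OF that, of 0] pts_closed(1) nrm_zero by force
  show "nrm (dual V) (\<phi> + \<psi>) \<le> nrm (dual V) \<phi> + nrm (dual V) \<psi>"
    if "\<phi> \<in> pts (dual V)" "\<psi> \<in> pts (dual V)" for \<phi> \<psi>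
    using dual_ball_le[OF that(1)] dual_ball_le[OF that(2)]
    by (intro dual_nrm_le) (simp, smt (verit))
  \<comment> \<open>The reverse inequality will be this one for \<open>1 / c\<close> and
    \<open>c *\<^sub>R \<phi>\<close>.\<close>
  have le: "nrm (dual V) (c *\<^sub>R \<phi>) \<le> \<bar>c\<bar> * nrm (dual V) \<phi>" if "\<phi> \<in> pts (dual V)" for c \<phi>
    using dual_ball_le[OF that]
    by (intro dual_nrm_le) (simp add: scaleR_fun_def abs_mult mult_left_mono)
  show "nrm (dual V) (c *\<^sub>R \<phi>) = \<bar>c\<bar> * nrm (dual V) \<phi>" if \<phi>: "\<phi> \<in> pts (dual V)" for c \<phi>
  proof (cases "c = 0")
    case True
    then show ?thesis
      using le[OF \<phi>, of 0] nonneg[OF subspace_0[OF sub]] by simp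
  next
    case False
    then show ?thesis
      using le[OF \<phi>, of c] le[OF subspace_scale[OF sub \<phi>], of "1 / c" c] by (simp add: field_simps)
  qed
qed

end

section \<open>Adjoint operators and closed spans\<close>

text \<open>The Banach space adjoint of \<open>A\<close>. The value 0 outside \<open>pts V\<close>
  keeps the representation of functionals unique.\<close>

definition pullback :: "'v::real_vector nspace \<Rightarrow> ('v \<Rightarrow> 'v) \<Rightarrow> ('v \<Rightarrow> real) \<Rightarrow> 'v \<Rightarrow> real" where
  "pullback V A \<phi> = (\<lambda>v. if v \<in> pts V then \<phi> (A v) else 0)"

lemma bounded_linear_map_pullback:
  assumes "seminormed_space V" and A: "bounded_linear_map V V A"
  shows "bounded_linear_map (dual V) (dual V) (pullback V A)"
proof -
  interpret seminormed_space V by fact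
  interpret D: seminormed_space "dual V" by (rule seminormed_dual)
  obtain K where K: "K > 0" "\<And>u. u \<in> pts V \<Longrightarrow> nrm V (A u) \<le> K * nrm V u"
    using bounded_map_pos[OF A] by blast
  note AD = bounded_linear_mapD[OF A]
  have le: "\<bar>\<phi> (A u)\<bar> \<le> nrm (dual V) \<phi> * K * nrm V u" if "\<phi> \<in> pts (dual V)" "u \<in> pts V" for \<phi> u
    using dual_apply_le[OF that(1) AD(1)[OF that(2)]]
      mult_left_mono[OF K(2)[OF that(2)] D.nrm_nonneg[OF that(1)]] by (simp add: mult.assoc)
  show ?thesis
  proof (rule bounded_linear_mapI[where K = K])
    fix \<phi> assume \<phi>: "\<phi> \<in> pts (dual V)"
    show "pullback V A \<phi> \<in> pts (dual V)"
      by (rule dualI[where K = "nrm (dual V) \<phi> * K"])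
        (use le[OF \<phi>] in \<open>auto simp: pullback_def AD dualD[OF \<phi>] pts_closed\<close>)
    show "nrm (dual V) (pullback V A \<phi>) \<le> K * nrm (dual V) \<phi>"
    proof (rule dual_nrm_le)
      fix u assume u: "u \<in> pts V" "nrm V u \<le> 1"
      have "nrm (dual V) \<phi> * K * nrm V u \<le> nrm (dual V) \<phi> * K"
        using mult_left_mono[OF u(2), of "nrm (dual V) \<phi> * K"] K(1) D.nrm_nonneg[OF \<phi>] by simp
      with le[OF \<phi> u(1)] u(1) show "\<bar>pullback V A \<phi> u\<bar> \<le> K * nrm (dual V) \<phi>"
        by (simp add: pullback_def mult.commute)
    qed
  qed (auto simp: pullback_def scaleR_fun_def)
qed

lemma pts_closed_span:
  "v \<in> pts (closed_span V S) \<longleftrightarrow> v \<in> pts V \<and> (\<forall>e>0. \<exists>w\<in>span S. nrm V (v - w) < e)"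
  by (simp add: closed_span_def)

lemma nrm_closed_span: "nrm (closed_span V S) = nrm V"
  by (simp add: closed_span_def)

context seminormed_space
begin

context
  fixes S assumes S: "S \<subseteq> pts V"
begin

lemma span_subset_pts: "span S \<subseteq> pts V"
  by (rule span_minimal[OF S subspace_pts])

lemma span_subset_closed_span: "span S \<subseteq> pts (closed_span V S)"
proof
  fix v assume "v \<in> span S"
  then show "v \<in> pts (closed_span V S)"
    using span_subset_pts nrm_zero by (auto simp: pts_closed_span intro!: bexI[of _ v])
qed

lemma closed_span_closed:
  assumes v: "v \<in> pts V" and "\<And>e. e > 0 \<Longrightarrow> \<exists>w\<in>pts (closed_span V S). nrm V (v - w) < e"
  shows "v \<in> pts (closed_span V S)"
  unfolding pts_closed_span
proof (intro conjI allI impI v)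
  fix e :: real assume "e > 0"
  then obtain w where w: "w \<in> pts (closed_span V S)" "nrm V (v - w) < e / 2"
    using assms(2)[of "e / 2"] by auto
  then obtain x where x: "x \<in> span S" "nrm V (w - x) < e / 2"
    using \<open>e > 0\<close> unfolding pts_closed_span by (meson half_gt_zero)
  have "nrm V (v - x) \<le> nrm V (v - w) + nrm V (w - x)"
    using v w x span_subset_pts by (intro nrm_diff_triangle) (auto simp: pts_closed_span)
  with w x show "\<exists>w\<in>span S. nrm V (v - w) < e" by (intro bexI[of _ x]) auto
qed

lemma seminormed_closed_span: "seminormed_space (closed_span V S)"
proof
  show "subspace (pts (closed_span V S))"
  proof (rule subspaceI)
    show "0 \<in> pts (closed_span V S)"
      using span_subset_closed_span span_zero by blast
  next
    fix u v assume u: "u \<in> pts (closed_span V S)" and v: "v \<in> pts (closed_span V S)"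
    show "u + v \<in> pts (closed_span V S)"
      unfolding pts_closed_span
    proof (intro conjI allI impI)
      fix e :: real assume "e > 0"
      then obtain x y where x: "x \<in> span S" "nrm V (u - x) < e / 2"
        and y: "y \<in> span S" "nrm V (v - y) < e / 2"
        using u v unfolding pts_closed_span by (meson half_gt_zero)
      have "nrm V ((u - x) + (v - y)) \<le> nrm V (u - x) + nrm V (v - y)"
        using u v x y span_subset_pts
        by (intro nrm_triangle) (auto simp: pts_closed_span pts_closed)
      moreover have "(u - x) + (v - y) = (u + v) - (x + y)" by simp
      ultimately show "\<exists>w\<in>span S. nrm V (u + v - w) < e"
        using x y by (intro bexI[of _ "x + y"]) (auto simp: span_add)
    qed (use u v in \<open>auto simp: pts_closed_span pts_closed\<close>)
  next
    fix c :: real and u assume u: "u \<in> pts (closed_span V S)"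
    show "c *\<^sub>R u \<in> pts (closed_span V S)"
      unfolding pts_closed_span
    proof (intro conjI allI impI)
      fix e :: real assume "e > 0"
      then have "e / (\<bar>c\<bar> + 1) > 0" by simp
      then obtain x where x: "x \<in> span S" "nrm V (u - x) < e / (\<bar>c\<bar> + 1)"
        using u unfolding pts_closed_span by meson
      have mem: "u - x \<in> pts V"
        using u x span_subset_pts by (auto simp: pts_closed_span pts_closed)
      have "nrm V (c *\<^sub>R u - c *\<^sub>R x) = \<bar>c\<bar> * nrm V (u - x)"
        using nrm_scaleR[OF mem, of c] by (simp add: scaleR_diff_right)
      also have "\<dots> \<le> (\<bar>c\<bar> + 1) * nrm V (u - x)"
        using nrm_nonneg[OF mem] by (simp add: distrib_right)
      also have "\<dots> < e"
        using x(2) by (simp add: field_simps)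
      finally show "\<exists>w\<in>span S. nrm V (c *\<^sub>R u - w) < e"
        using x by (intro bexI[of _ "c *\<^sub>R x"]) (auto simp: span_scale)
    qed (use u in \<open>auto simp: pts_closed_span pts_closed\<close>)
  qed
qed (auto simp: pts_closed_span nrm_closed_span nrm_nonneg nrm_triangle nrm_scaleR)

text \<open>The points that \<open>T\<close> sends into the closed span form a subspace containing
  \<open>S\<close>, and boundedness of \<open>T\<close> passes this on to limits. Hence adjoints
  need to be examined on evaluations only.\<close>

lemma closed_span_map:
  assumes T: "bounded_linear_map V V T" and TS: "\<And>a. a \<in> S \<Longrightarrow> T a \<in> pts (closed_span V S)"
    and v: "v \<in> pts (closed_span V S)"
  shows "T v \<in> pts (closed_span V S)"
proof -
  interpret C: seminormed_space "closed_span V S" by (rule seminormed_closed_span)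
  note TD = bounded_linear_mapD[OF T]
  have "subspace {w \<in> pts V. T w \<in> pts (closed_span V S)}"
    by (rule subspaceI) (auto simp: pts_closed C.pts_closed TD bounded_map_zero[OF T])
  then have sp: "T w \<in> pts (closed_span V S)" if "w \<in> span S" for w
    using span_minimal[of S "{w \<in> pts V. T w \<in> pts (closed_span V S)}"] S TS that by blast
  obtain K where K: "K > 0" "\<And>u. u \<in> pts V \<Longrightarrow> nrm V (T u) \<le> K * nrm V u"
    using bounded_map_pos[OF T] by blast
  have vV: "v \<in> pts V" using v by (simp add: pts_closed_span)
  show ?thesis
  proof (rule closed_span_closed)
    fix e :: real assume "e > 0"
    then have "e / K > 0" using K by simp
    then obtain w where w: "w \<in> span S" "nrm V (v - w) < e / K"
      using v unfolding pts_closed_span by meson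
    have wV: "w \<in> pts V" using w span_subset_pts by blast
    have "nrm V (T v - T w) \<le> K * nrm V (v - w)"
      using K(2)[of "v - w"] bounded_map_diff[OF T vV wV] pts_closed(5)[OF vV wV] by simp
    also have "\<dots> < e" using w K by (simp add: field_simps)
    finally show "\<exists>w\<in>pts (closed_span V S). nrm V (T v - w) < e"
      using sp[OF w(1)] by blast
  qed (use TD(1)[OF vV] in simp)
qed

end

end

text \<open>
  Both maps of the factorisation through the closed span are adjoints, so that it suffices to
  check the identity and the norm estimates on the predual \<open>V\<close>.
\<close>
theorem closed_span_dual_isomorphic_l1_sum:
  fixes A B :: "nat \<Rightarrow> 'v::real_vector \<Rightarrow> 'v"
  assumes V: "seminormed_space V" and S: "S \<subseteq> pts (dual V)" and "C \<ge> 0"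
    and A: "\<And>n. bounded_linear_map V V (A n)" and B: "\<And>n. bounded_linear_map V V (B n)"
    and B_le: "\<And>n f. f \<in> pts V \<Longrightarrow> nrm V (B n f) \<le> C * nrm V f"
    and A_le: "\<And>m f. (\<And>n. f n \<in> pts V) \<Longrightarrow> (\<And>n. nrm V (f n) \<le> 1) \<Longrightarrow>
      nrm V (\<Sum>n<m. A n (f n)) \<le> C"
    and BA: "\<And>n m f. f \<in> pts V \<Longrightarrow> B n (A m f) = (if n = m then f else 0)"
    and AS: "\<And>n a. a \<in> S \<Longrightarrow> pullback V (A n) a \<in> pts (closed_span (dual V) S)"
    and BS: "\<And>n a. a \<in> S \<Longrightarrow> pullback V (B n) a \<in> pts (closed_span (dual V) S)"
  shows "linearly_isomorphic (closed_span (dual V) S) (l1_sum (closed_span (dual V) S))"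
proof -
  interpret V: seminormed_space V by fact
  interpret D: seminormed_space "dual V" by (rule V.seminormed_dual)
  define Y where "Y = closed_span (dual V) S"
  have Ysn: "seminormed_space Y"
    unfolding Y_def by (rule D.seminormed_closed_span[OF S])
  interpret Y: seminormed_space Y by (rule Ysn)
  have nrmY: "nrm Y = nrm (dual V)" by (simp add: Y_def nrm_closed_span)
  have YD: "\<phi> \<in> pts (dual V)" if "\<phi> \<in> pts Y" for \<phi>
    using that by (simp add: Y_def pts_closed_span)
  note pbA = bounded_linear_map_pullback[OF V A] and pbB = bounded_linear_map_pullback[OF V B]
  have pAY: "pullback V (A n) \<phi> \<in> pts Y" and pBY: "pullback V (B n) \<phi> \<in> pts Y"
    if "\<phi> \<in> pts Y" for \<phi> n
    using D.closed_span_map[OF S pbA AS] D.closed_span_map[OF S pbB BS] that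
    unfolding Y_def by blast+
  define R where "R = (\<lambda>\<phi> n. pullback V (A n) \<phi>)"
  \<comment> \<open>The series is summed pointwise on \<open>V\<close>. That its sum lies in the
    closed span is a separate matter, settled in \<open>J_Y\<close>.\<close>
  define J where "J = (\<lambda>s f. if f \<in> pts V then \<Sum>n. s n (B n f) else (0::real))"
  \<comment> \<open>Duality of \<open>\<ell>\<^sub>1\<close> and
    \<open>\<ell>\<^sub>\<infinity>\<close>: each norm is nearly attained at some \<open>f n\<close>
    in the unit ball, and the sum of these values is \<phi> at the sum of the
    \<open>A n (f n)\<close>, a vector of norm at most \<open>C\<close>. The \<open>m\<close> errors
    \<open>d / Suc m\<close> total less than \<open>d\<close>.\<close>
  have R_le: "(\<Sum>n<m. nrm (dual V) (pullback V (A n) \<phi>)) \<le> C * nrm (dual V) \<phi>"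
    if \<phi>: "\<phi> \<in> pts (dual V)" for \<phi> m
  proof (rule field_le_epsilon)
    fix d :: real assume "d > 0"
    then have e: "d / Suc m > 0" by simp
    have "\<exists>v\<in>pts V. nrm V v \<le> 1 \<and>
        nrm (dual V) (pullback V (A n) \<phi>) - d / Suc m < pullback V (A n) \<phi> v" for n
      using V.dual_norming[OF bounded_linear_mapD(1)[OF pbA \<phi>] e] by blast
    then obtain f where f: "\<And>n. f n \<in> pts V" "\<And>n. nrm V (f n) \<le> 1"
      "\<And>n. nrm (dual V) (pullback V (A n) \<phi>) - d / Suc m < pullback V (A n) \<phi> (f n)"
      by metis
    have Af: "A n (f n) \<in> pts V" for n
      using bounded_linear_mapD(1)[OF A] f(1) by blast
    have "(\<Sum>n<m. nrm (dual V) (pullback V (A n) \<phi>)) \<le> (\<Sum>n<m. \<phi> (A n (f n)) + d / Suc m)"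
    proof (rule sum_mono)
      show "nrm (dual V) (pullback V (A n) \<phi>) \<le> \<phi> (A n (f n)) + d / Suc m" for n
        using f(3)[of n] f(1)[of n] by (simp add: pullback_def)
    qed
    also have "\<dots> = \<phi> (\<Sum>n<m. A n (f n)) + m * (d / Suc m)"
      using V.bounded_map_sum[of "\<lparr> pts = UNIV, nrm = abs \<rparr>" \<phi> "{..<m}" "\<lambda>n. A n (f n)"] \<phi> Af
      by (simp add: pts_dual sum.distrib)
    also have "\<dots> \<le> nrm (dual V) \<phi> * C + d"
    proof (rule add_mono)
      have "\<bar>\<phi> (\<Sum>n<m. A n (f n))\<bar> \<le> nrm (dual V) \<phi> * nrm V (\<Sum>n<m. A n (f n))"
        by (rule V.dual_apply_le[OF \<phi>]) (simp add: V.pts_closed Af)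
      also have "\<dots> \<le> nrm (dual V) \<phi> * C"
        using A_le[of f m] f D.nrm_nonneg[OF \<phi>] by (intro mult_left_mono) auto
      finally show "\<phi> (\<Sum>n<m. A n (f n)) \<le> nrm (dual V) \<phi> * C" by simp
    qed (use \<open>d > 0\<close> in \<open>simp add: field_simps\<close>)
    finally show "(\<Sum>n<m. nrm (dual V) (pullback V (A n) \<phi>)) \<le> C * nrm (dual V) \<phi> + d"
      by (simp add: mult.commute)
  qed
  have R_sm: "summable (\<lambda>n. nrm (dual V) (pullback V (A n) \<phi>))" if "\<phi> \<in> pts (dual V)" for \<phi>
    by (rule summableI_nonneg_bounded[where x = "C * nrm (dual V) \<phi>"])
      (use R_le[OF that] D.nrm_nonneg bounded_linear_mapD(1)[OF pbA that] in auto)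
  have R: "bounded_linear_map Y (l1_sum Y) R"
  proof (rule bounded_linear_mapI[where K = C])
    fix \<phi> assume \<phi>: "\<phi> \<in> pts Y"
    show "R \<phi> \<in> pts (l1_sum Y)"
      using R_sm[OF YD[OF \<phi>]] pAY[OF \<phi>] by (simp add: R_def pts_l1_sum nrmY)
    show "nrm (l1_sum Y) (R \<phi>) \<le> C * nrm Y \<phi>"
      unfolding nrm_l1_sum R_def nrmY
      by (rule suminf_le_const[OF R_sm R_le]) (rule YD[OF \<phi>])+
  qed (auto simp: R_def pullback_def scaleR_fun_def fun_eq_iff)
  have B_mem: "B n f \<in> pts V" if "f \<in> pts V" for n f
    by (rule bounded_linear_mapD(1)[OF B that])
  have sn: "s n \<in> pts (dual V)" "s n \<in> pts Y" if "s \<in> pts (l1_sum Y)" for s n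
    using that YD by (auto simp: pts_l1_sum)
  have term_le: "\<bar>s n (B n f)\<bar> \<le> C * nrm V f * nrm Y (s n)"
    if "s \<in> pts (l1_sum Y)" "f \<in> pts V" for s n f
  proof -
    have "\<bar>s n (B n f)\<bar> \<le> nrm Y (s n) * nrm V (B n f)"
      unfolding nrmY using V.dual_apply_le sn(1) B_mem that by blast
    also have "\<dots> \<le> nrm Y (s n) * (C * nrm V f)"
      using B_le[OF that(2)] Y.nrm_nonneg[OF sn(2)[OF that(1)]] by (intro mult_left_mono)
    finally show ?thesis by (simp add: mult.commute)
  qed
  have g_sm: "summable (\<lambda>n. C * nrm V f * nrm Y (s n))" if "s \<in> pts (l1_sum Y)" for s f
    using that by (auto simp: pts_l1_sum intro: summable_mult)
  have J_asm: "summable (\<lambda>n. \<bar>s n (B n f)\<bar>)" if "s \<in> pts (l1_sum Y)" "f \<in> pts V" for s f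
    by (rule summable_comparison_test'[OF g_sm[OF that(1), of f], where N = 0])
      (use term_le that in auto)
  have J_sm: "summable (\<lambda>n. s n (B n f))" if "s \<in> pts (l1_sum Y)" "f \<in> pts V" for s f
    using J_asm[OF that] by (rule summable_rabs_cancel)
  have tail_le: "\<bar>\<Sum>n. s (n + m) (B (n + m) f)\<bar> \<le> C * (\<Sum>n. nrm Y (s (n + m))) * nrm V f"
    if s: "s \<in> pts (l1_sum Y)" and f: "f \<in> pts V" for s f m
  proof -
    have "\<bar>\<Sum>n. s (n + m) (B (n + m) f)\<bar> \<le> (\<Sum>n. \<bar>s (n + m) (B (n + m) f)\<bar>)"
      using J_asm[OF s f] by (intro summable_rabs) (rule summable_ignore_initial_segment)
    also have "\<dots> \<le> (\<Sum>n. C * nrm V f * nrm Y (s (n + m)))"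
      using term_le[OF s f] J_asm[OF s f] g_sm[OF s, of f]
      by (intro suminf_le) (auto intro: summable_ignore_initial_segment
          summable_ignore_initial_segment[of "\<lambda>n. C * nrm V f * nrm Y (s n)"])
    also have "\<dots> = C * (\<Sum>n. nrm Y (s (n + m))) * nrm V f"
      using s by (subst suminf_mult)
        (auto simp: pts_l1_sum intro: summable_ignore_initial_segment[of "\<lambda>n. nrm Y (s n)"])
    finally show ?thesis .
  qed
  have J_le: "\<bar>J s f\<bar> \<le> C * nrm (l1_sum Y) s * nrm V f"
    if "s \<in> pts (l1_sum Y)" "f \<in> pts V" for s f
    using tail_le[OF that, of 0] that by (simp add: J_def nrm_l1_sum)
  have J_dual: "J s \<in> pts (dual V)" if s: "s \<in> pts (l1_sum Y)" for s
  proof (rule dualI)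
    fix f g assume f: "f \<in> pts V" and g: "g \<in> pts V"
    have "s n (B n (f + g)) = s n (B n f) + s n (B n g)" for n
      using f g by (simp add: bounded_linear_mapD(2)[OF B] dualD(1)[OF sn(1)[OF s]] B_mem)
    then show "J s (f + g) = J s f + J s g"
      using f g J_sm[OF s] by (simp add: J_def V.pts_closed suminf_add)
  next
    fix c f assume f: "f \<in> pts V"
    have "s n (B n (c *\<^sub>R f)) = c * s n (B n f)" for n
      using f by (simp add: bounded_linear_mapD(3)[OF B] dualD(2)[OF sn(1)[OF s]] B_mem)
    then show "J s (c *\<^sub>R f) = c * J s f"
      using f J_sm[OF s] by (simp add: J_def V.pts_closed suminf_mult)
  qed (use J_le[OF s] in \<open>auto simp: J_def\<close>)
  \<comment> \<open>The partial sums are pullbacks of members of \<open>Y\<close>, and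
    \<open>tail_le\<close> bounds the remainder uniformly on the unit ball, so they converge in the
    dual norm. Dividing by \<open>C + 1\<close> covers \<open>C = 0\<close>.\<close>
  have J_Y: "J s \<in> pts Y" if s: "s \<in> pts (l1_sum Y)" for s
    unfolding Y_def
  proof (rule D.closed_span_closed[OF S J_dual[OF s]])
    fix e :: real assume "e > 0"
    then have "e / (C + 1) > 0" using \<open>C \<ge> 0\<close> by simp
    then obtain m where m: "norm (\<Sum>n. nrm Y (s (n + m))) < e / (C + 1)"
      using suminf_exist_split[of "e / (C + 1)" "\<lambda>n. nrm Y (s n)"] s
      unfolding pts_l1_sum by blast
    define q where "q = (\<Sum>n<m. pullback V (B n) (s n))"
    have q: "q \<in> pts Y"
      unfolding q_def using pBY[OF sn(2)[OF s]] by (intro Y.pts_closed) auto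
    have q_apply: "q f = (\<Sum>n<m. s n (B n f))" if "f \<in> pts V" for f
      unfolding q_def using that by (induction m) (auto simp: pullback_def)
    have "nrm (dual V) (J s - q) \<le> C * (\<Sum>n. nrm Y (s (n + m)))"
    proof (rule V.dual_nrm_le)
      fix f assume f: "f \<in> pts V" "nrm V f \<le> 1"
      have "(J s - q) f = (\<Sum>n. s (n + m) (B (n + m) f))"
        using f(1) q_apply[OF f(1)] suminf_minus_initial_segment[OF J_sm[OF s f(1)], of m]
        by (simp add: J_def)
      with tail_le[OF s f(1), of m] have "\<bar>(J s - q) f\<bar> \<le> C * (\<Sum>n. nrm Y (s (n + m))) * nrm V f"
        by simp
      also have "\<dots> \<le> C * (\<Sum>n. nrm Y (s (n + m))) * 1"
      proof (rule mult_left_mono[OF f(2)])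
        have "summable (\<lambda>n. nrm Y (s (n + m)))"
          using s summable_ignore_initial_segment[of "\<lambda>n. nrm Y (s n)" m] by (simp add: pts_l1_sum)
        then show "0 \<le> C * (\<Sum>n. nrm Y (s (n + m)))"
          using \<open>C \<ge> 0\<close> Y.nrm_nonneg[OF sn(2)[OF s]]
          by (intro mult_nonneg_nonneg suminf_nonneg)
      qed
      finally show "\<bar>(J s - q) f\<bar> \<le> C * (\<Sum>n. nrm Y (s (n + m)))" by simp
    qed
    also have "\<dots> \<le> C * (e / (C + 1))"
      using m \<open>C \<ge> 0\<close> by (intro mult_left_mono) auto
    also have "\<dots> < e"
      using \<open>e > 0\<close> \<open>C \<ge> 0\<close> by (simp add: field_simps)
    finally show "\<exists>w\<in>pts (closed_span (dual V) S). nrm (dual V) (J s - w) < e"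
      using q unfolding Y_def by blast
  qed
  have l1_nonneg: "0 \<le> nrm (l1_sum Y) s" if "s \<in> pts (l1_sum Y)" for s
    using seminormed_space.nrm_nonneg[OF seminormed_l1_sum[OF Ysn] that] .
  have J: "bounded_linear_map (l1_sum Y) Y J"
  proof (rule bounded_linear_mapI[where K = C])
    fix s assume s: "s \<in> pts (l1_sum Y)"
    show "J s \<in> pts Y" by (rule J_Y[OF s])
    show "nrm Y (J s) \<le> C * nrm (l1_sum Y) s"
      unfolding nrmY
    proof (rule V.dual_nrm_le)
      fix f assume f: "f \<in> pts V" "nrm V f \<le> 1"
      have "C * nrm (l1_sum Y) s * nrm V f \<le> C * nrm (l1_sum Y) s * 1"
        using f(2) \<open>C \<ge> 0\<close> l1_nonneg[OF s] by (intro mult_left_mono) auto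
      with J_le[OF s f(1)] show "\<bar>J s f\<bar> \<le> C * nrm (l1_sum Y) s" by simp
    qed
  next
    fix s t assume "s \<in> pts (l1_sum Y)" "t \<in> pts (l1_sum Y)"
    then show "J (s + t) = J s + J t"
      by (auto simp: J_def fun_eq_iff suminf_add J_sm)
  next
    fix c s assume "s \<in> pts (l1_sum Y)"
    then show "J (c *\<^sub>R s) = c *\<^sub>R J s"
      by (auto simp: J_def fun_eq_iff scaleR_fun_def suminf_mult J_sm)
  qed
  have "R (J s) m f = s m f" if s: "s \<in> pts (l1_sum Y)" for s m f
  proof (cases "f \<in> pts V")
    case True
    have "s n 0 = 0" for n
      using dualD(2)[OF sn(1)[OF s], of 0 n 0] V.pts_closed(1) by simp
    then have "(\<Sum>n. s n (B n (A m f))) = (\<Sum>n\<in>{m}. s n (B n (A m f)))"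
      using True by (intro suminf_finite) (auto simp: BA)
    with True show ?thesis
      by (simp add: R_def pullback_def J_def bounded_linear_mapD(1)[OF A] BA)
  next
    case False
    then show ?thesis
      by (simp add: R_def pullback_def dualD(3)[OF sn(1)[OF s]])
  qed
  then have "R (J s) = s" if "s \<in> pts (l1_sum Y)" for s
    using that by blast
  from linearly_isomorphic_l1_sum_if_complemented[OF Ysn J R this] show ?thesis
    unfolding Y_def .
qed

section \<open>Spaces of Lipschitz functions\<close>

lemma pts_Lip0:
  "f \<in> pts (Lip0 M p) \<longleftrightarrow> (\<exists>L. L-lipschitz_on M f) \<and> f p = 0 \<and> (\<forall>x. x \<notin> M \<longrightarrow> f x = 0)"
  by (simp add: Lip0_def)

lemma Lip0_nrm_le:
  assumes "L-lipschitz_on M f" shows "nrm (Lip0 M p) f \<le> L"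
proof -
  have "bdd_below {L. L-lipschitz_on M f}"
    by (auto simp: bdd_below_def intro: lipschitz_on_nonneg)
  then show ?thesis
    using assms by (auto simp: Lip0_def intro: cInf_lower)
qed

text \<open>Each difference quotient is a lower bound of the admissible constants, hence at most
  their infimum.\<close>

lemma Lip0_lipschitz:
  assumes "f \<in> pts (Lip0 M p)" shows "(nrm (Lip0 M p) f)-lipschitz_on M f"
proof -
  have ne: "{L. L-lipschitz_on M f} \<noteq> {}"
    using assms by (auto simp: pts_Lip0)
  show ?thesis
  proof (rule lipschitz_onI)
    fix x y assume xy: "x \<in> M" "y \<in> M"
    show "dist (f x) (f y) \<le> nrm (Lip0 M p) f * dist x y"
    proof (cases "x = y")
      case False
      have "dist (f x) (f y) / dist x y \<le> Inf {L. L-lipschitz_on M f}"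
        using False xy by (intro cInf_greatest[OF ne]) (auto simp: field_simps dest: lipschitz_onD)
      then show ?thesis
        using False by (simp add: Lip0_def field_simps)
    qed simp
  next
    show "0 \<le> nrm (Lip0 M p) f"
      using cInf_greatest[OF ne, of 0] by (auto simp: Lip0_def intro: lipschitz_on_nonneg)
  qed
qed

lemma lipschitz_on_real:
  fixes f :: "'a::metric_space \<Rightarrow> real"
  shows "L-lipschitz_on M f \<longleftrightarrow> 0 \<le> L \<and> (\<forall>x\<in>M. \<forall>y\<in>M. \<bar>f x - f y\<bar> \<le> L * dist x y)"
  by (simp add: lipschitz_on_def dist_real_def)

lemma seminormed_Lip0: "seminormed_space (Lip0 M p)"
proof
  note lip = Lip0_lipschitz[of _ M p, unfolded lipschitz_on_real]
  have add: "(nrm (Lip0 M p) f + nrm (Lip0 M p) g)-lipschitz_on M (f + g)"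
    if "f \<in> pts (Lip0 M p)" "g \<in> pts (Lip0 M p)" for f g
    using lipschitz_on_add[OF Lip0_lipschitz[OF that(1)] Lip0_lipschitz[OF that(2)]]
    by (simp add: plus_fun_def)
  have scale: "(\<bar>c\<bar> * nrm (Lip0 M p) f)-lipschitz_on M (c *\<^sub>R f)"
    if "f \<in> pts (Lip0 M p)" for c f
    using lipschitz_on_cmult_real[OF Lip0_lipschitz[OF that]] by (simp add: scaleR_fun_def)
  show sub: "subspace (pts (Lip0 M p))"
  proof (rule subspaceI)
    show "0 \<in> pts (Lip0 M p)"
      using lipschitz_on_constant[of M "0::real"] by (auto simp: pts_Lip0 zero_fun_def)
  next
    show "f + g \<in> pts (Lip0 M p)" if "f \<in> pts (Lip0 M p)" "g \<in> pts (Lip0 M p)" for f g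
      using add[OF that] that by (auto simp: pts_Lip0)
  next
    show "c *\<^sub>R f \<in> pts (Lip0 M p)" if "f \<in> pts (Lip0 M p)" for c f
      using scale[OF that] that by (auto simp: pts_Lip0 scaleR_fun_def)
  qed
  show nonneg: "0 \<le> nrm (Lip0 M p) f" if "f \<in> pts (Lip0 M p)" for f
    using lip[OF that] by simp
  show "nrm (Lip0 M p) (f + g) \<le> nrm (Lip0 M p) f + nrm (Lip0 M p) g"
    if "f \<in> pts (Lip0 M p)" "g \<in> pts (Lip0 M p)" for f g
    by (rule Lip0_nrm_le[OF add[OF that]])
  note le = Lip0_nrm_le[OF scale, where p = p]
  show "nrm (Lip0 M p) (c *\<^sub>R f) = \<bar>c\<bar> * nrm (Lip0 M p) f" if f: "f \<in> pts (Lip0 M p)" for c f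
  proof (cases "c = 0")
    case True
    then show ?thesis
      using le[OF f, of 0] nonneg[OF subspace_0[OF sub]] by simp
  next
    case False
    then show ?thesis
      using le[OF f, of c] le[OF subspace_scale[OF sub f], of "1 / c" c] by (simp add: field_simps)
  qed
qed

lemma evaluation_in_dual:
  assumes "p \<in> M" "x \<in> M"
  shows "evaluation M p x \<in> pts (dual (Lip0 M p))"
proof (rule dualI[where K = "dist x p"])
  show "\<bar>evaluation M p x f\<bar> \<le> dist x p * nrm (Lip0 M p) f" if f: "f \<in> pts (Lip0 M p)" for f
  proof -
    have "f p = 0" using f by (simp add: pts_Lip0)
    then show ?thesis
      using lipschitz_onD[OF Lip0_lipschitz[OF f] assms(2,1)] f
      by (simp add: evaluation_def mult.commute)
  qed
next
  fix c f assume f: "f \<in> pts (Lip0 M p)"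
  have "(c *\<^sub>R f) x = c * f x" by (simp add: scaleR_fun_def)
  then show "evaluation M p x (c *\<^sub>R f) = c * evaluation M p x f"
    using f seminormed_space.pts_closed(3)[OF seminormed_Lip0 f] by (simp add: evaluation_def)
qed (simp_all add: evaluation_def seminormed_space.pts_closed[OF seminormed_Lip0])

lemma bounded_linear_map_Lip0I:
  assumes lin: "\<And>f g x. A (f + g) x = A f x + A g x" "\<And>c f x. A (c *\<^sub>R f) x = c * A f x"
    and lip: "\<And>f L. f \<in> pts (Lip0 M p) \<Longrightarrow> L-lipschitz_on M f \<Longrightarrow> (C * L)-lipschitz_on M (A f)"
    and "\<And>f. f \<in> pts (Lip0 M p) \<Longrightarrow> A f p = 0" and "\<And>f x. x \<notin> M \<Longrightarrow> A f x = 0"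
  shows "bounded_linear_map (Lip0 M p) (Lip0 M p) A"
    and "f \<in> pts (Lip0 M p) \<Longrightarrow> nrm (Lip0 M p) (A f) \<le> C * nrm (Lip0 M p) f"
proof -
  show le: "nrm (Lip0 M p) (A f) \<le> C * nrm (Lip0 M p) f" if "f \<in> pts (Lip0 M p)" for f
    by (rule Lip0_nrm_le[OF lip[OF that Lip0_lipschitz[OF that]]])
  show "bounded_linear_map (Lip0 M p) (Lip0 M p) A"
  proof (rule bounded_linear_mapI[where K = C])
    show "A f \<in> pts (Lip0 M p)" if "f \<in> pts (Lip0 M p)" for f
      using assms(4,5) lip[OF that Lip0_lipschitz[OF that]] that by (auto simp: pts_Lip0)
  qed (use lin le in \<open>auto simp: scaleR_fun_def\<close>)
qed

section \<open>Cutoff functions\<close>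

text \<open>Product rule: the slope of \<open>w\<close> is weighted by the size of \<open>h\<close>,
  which is at most \<open>K * R\<close> within distance \<open>R\<close> of \<open>p\<close> because
  \<open>h p = 0\<close>. A cutoff on the scale \<open>R\<close> has \<open>L * R\<close> bounded,
  so the resulting constant does not depend on the scale.\<close>

lemma lipschitz_on_cutoff_scaleR:
  fixes h :: "'a::metric_space \<Rightarrow> 'b::real_normed_vector"
  assumes h: "K-lipschitz_on S h" "h p = 0" "p \<in> S" and w: "L-lipschitz_on S w"
    and w_le: "\<And>x. \<bar>w x\<bar> \<le> 1" and w_0: "\<And>x. R \<le> dist x p \<Longrightarrow> w x = 0" and "R \<ge> 0"
  shows "(K * (1 + L * R))-lipschitz_on S (\<lambda>x. w x *\<^sub>R h x)"
proof -
  have nonneg: "K \<ge> 0" "L \<ge> 0"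
    using h(1) w by (auto intro: lipschitz_on_nonneg)
  \<comment> \<open>By symmetry \<open>y\<close> may be the point closer to \<open>p\<close>. If it
    is at distance at least \<open>R\<close>, both products vanish; otherwise \<open>h y\<close> is
    under control and only \<open>h x - h y\<close> involves \<open>x\<close>.\<close>
  have *: "dist (w x *\<^sub>R h x) (w y *\<^sub>R h y) \<le> K * (1 + L * R) * dist x y"
    if xy: "x \<in> S" "y \<in> S" "dist y p \<le> dist x p" for x y
  proof (cases "R \<le> dist y p")
    case True
    with xy show ?thesis using w_0[of x] w_0[of y] nonneg \<open>R \<ge> 0\<close> by simp
  next
    case False
    have "norm (h y) \<le> K * dist y p"
      using lipschitz_onD[OF h(1) xy(2) h(3)] h(2) by (simp add: dist_norm)
    also have "\<dots> \<le> K * R"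
      using False nonneg by (intro mult_left_mono) auto
    finally have hy: "norm (h y) \<le> K * R" .
    have "w x *\<^sub>R h x - w y *\<^sub>R h y = w x *\<^sub>R (h x - h y) + (w x - w y) *\<^sub>R h y"
      by (simp add: algebra_simps)
    then have "dist (w x *\<^sub>R h x) (w y *\<^sub>R h y) \<le> \<bar>w x\<bar> * dist (h x) (h y) + \<bar>w x - w y\<bar> * norm (h y)"
      by (metis dist_norm norm_scaleR norm_triangle_ineq)
    also have "\<dots> \<le> 1 * (K * dist x y) + (L * dist x y) * (K * R)"
      using w_le[of x] lipschitz_onD[OF h(1) xy(1,2)] lipschitz_onD[OF w xy(1,2)] hy nonneg
      by (intro add_mono mult_mono) (auto simp: dist_real_def)
    finally show ?thesis by (simp add: algebra_simps)
  qed
  show ?thesis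
  proof (rule lipschitz_onI)
    fix x y assume "x \<in> S" "y \<in> S"
    then show "dist (w x *\<^sub>R h x) (w y *\<^sub>R h y) \<le> K * (1 + L * R) * dist x y"
      using *[of x y] *[of y x] by (cases "dist y p \<le> dist x p") (auto simp: dist_commute)
  qed (use nonneg \<open>R \<ge> 0\<close> in simp)
qed

text \<open>If \<open>x\<close> and \<open>y\<close> have different active indices \<open>i\<close>
  and \<open>j\<close>, then \<open>g i y = 0\<close> and \<open>g j x = 0\<close>, so
  \<open>F x - F y\<close> is \<open>(g i x - g i y) + (g j x - g j y)\<close>. This is the source
  of the factor 2.\<close>

lemma lipschitz_on_disjoint_supports:
  fixes F :: "'a::metric_space \<Rightarrow> real"
  assumes g: "\<And>i. K-lipschitz_on S (g i)"
    and F: "\<And>x. x \<in> S \<Longrightarrow> \<exists>i. F x = g i x \<and> (\<forall>j. j \<noteq> i \<longrightarrow> g j x = 0)"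
  shows "(2 * K)-lipschitz_on S F"
proof (rule lipschitz_onI)
  have K: "K \<ge> 0" using g lipschitz_on_nonneg by blast
  then show "0 \<le> 2 * K" by simp
  fix x y assume xy: "x \<in> S" "y \<in> S"
  obtain i where i: "F x = g i x" "\<And>j. j \<noteq> i \<Longrightarrow> g j x = 0" using F[OF xy(1)] by blast
  obtain j where j: "F y = g j y" "\<And>i. i \<noteq> j \<Longrightarrow> g i y = 0" using F[OF xy(2)] by blast
  have gi: "\<bar>g i x - g i y\<bar> \<le> K * dist x y" and gj: "\<bar>g j x - g j y\<bar> \<le> K * dist x y"
    using g xy unfolding lipschitz_on_real by blast+
  have "0 \<le> K * dist x y" using K by simp
  then show "dist (F x) (F y) \<le> 2 * K * dist x y"
    using i j gi gj by (cases "i = j") (auto simp: dist_real_def)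
qed

definition cutoff :: "'a::metric_space \<Rightarrow> real \<Rightarrow> 'a \<Rightarrow> real" where
  "cutoff p r x = max 0 (min 1 (2 - dist x p / r))"

lemma cutoff_bounds: "0 \<le> cutoff p r x" "cutoff p r x \<le> 1"
  by (auto simp: cutoff_def)

lemma cutoff_eq_1: "r > 0 \<Longrightarrow> dist x p \<le> r \<Longrightarrow> cutoff p r x = 1"
  by (simp add: cutoff_def field_simps)

lemma cutoff_eq_0: "r > 0 \<Longrightarrow> 2 * r \<le> dist x p \<Longrightarrow> cutoff p r x = 0"
  by (simp add: cutoff_def field_simps)

lemma cutoff_lipschitz:
  assumes "r > 0" shows "(1 / r)-lipschitz_on S (cutoff p r)"
  unfolding lipschitz_on_real
proof (intro conjI ballI)
  fix x y
  have "\<bar>cutoff p r x - cutoff p r y\<bar> \<le> \<bar>dist x p / r - dist y p / r\<bar>"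
    by (auto simp: cutoff_def)
  also have "\<dots> = \<bar>dist x p - dist y p\<bar> / r"
    using assms by (simp add: diff_divide_distrib[symmetric])
  also have "\<dots> \<le> dist x y / r"
    using assms dist_triangle[of x p y] dist_triangle2[of y p x]
    by (intro divide_right_mono) (auto simp: abs_le_iff dist_commute algebra_simps)
  finally show "\<bar>cutoff p r x - cutoff p r y\<bar> \<le> 1 / r * dist x y" by simp
qed (use assms in simp)

section \<open>A dyadic partition of unity\<close>

text \<open>Differences of consecutive cutoffs, so that sums telescope. For positive
  \<open>k\<close> the weight lives where the distance from \<open>p\<close> is between
  \<open>2 ^ (k - 1)\<close> and \<open>2 ^ (k + 1)\<close>; for \<open>k = 0\<close> it lives on
  the ball of radius 2.\<close>

fun dyadic :: "'a::metric_space \<Rightarrow> nat \<Rightarrow> 'a \<Rightarrow> real" where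
  "dyadic p 0 x = cutoff p 1 x"
| "dyadic p (Suc k) x = cutoff p (2 ^ Suc k) x - cutoff p (2 ^ k) x"

lemma sum_dyadic: "(\<Sum>k\<le>m. dyadic p k x) = cutoff p (2 ^ m) x"
  by (induction m) auto

lemma abs_dyadic_le: "\<bar>dyadic p k x\<bar> \<le> 1"
proof (cases k)
  case (Suc j)
  then show ?thesis
    using cutoff_bounds[of p "2 ^ Suc j" x] cutoff_bounds[of p "2 ^ j" x] by (simp add: abs_le_iff)
qed (use cutoff_bounds[of p 1 x] in simp)

lemma dyadic_outside: "2 * 2 ^ k \<le> dist x p \<Longrightarrow> dyadic p k x = 0"
proof (cases k)
  case (Suc j)
  assume "2 * 2 ^ k \<le> dist x p"
  moreover have "(0::real) < 2 ^ j" by simp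
  ultimately have "2 * 2 ^ j \<le> dist x p" "2 * (2 * 2 ^ j) \<le> dist x p"
    unfolding Suc power_Suc by linarith+
  then show ?thesis
    using Suc by (simp add: cutoff_eq_0)
qed (simp add: cutoff_eq_0)

lemma dyadic_inside:
  assumes "dist x p \<le> 2 ^ j" "j < k" shows "dyadic p k x = 0"
proof -
  obtain i where k: "k = Suc i" and "j \<le> i" using assms(2) by (cases k) auto
  have "dist x p \<le> 2 ^ i"
    using assms(1) power_increasing[OF \<open>j \<le> i\<close>, of "2::real"] by linarith
  moreover have "(0::real) < 2 ^ i" by simp
  ultimately have "cutoff p (2 ^ i) x = 1" "cutoff p (2 * 2 ^ i) x = 1"
    using \<open>dist x p \<le> 2 ^ i\<close> by (intro cutoff_eq_1; linarith)+
  then show ?thesis by (simp add: k)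
qed

text \<open>For positive \<open>k\<close> the constant is
  \<open>1 / 2 ^ k + 1 / 2 ^ (k - 1)\<close>, the slopes of the two cutoffs.\<close>

lemma dyadic_lipschitz: "(3 / 2 ^ k)-lipschitz_on S (dyadic p k)"
proof (cases k)
  case 0
  have "dyadic p 0 = cutoff p 1" by auto
  then show ?thesis
    using lipschitz_on_le[OF cutoff_lipschitz[of 1 S p], of 3] 0 by simp
next
  case (Suc j)
  have eq: "dyadic p k = (\<lambda>x. cutoff p (2 ^ Suc j) x - cutoff p (2 ^ j) x)"
    using Suc by auto
  have "(1 / 2 ^ Suc j + 1 / 2 ^ j)-lipschitz_on S (dyadic p k)"
    unfolding eq by (intro lipschitz_on_diff cutoff_lipschitz) auto
  then show ?thesis
    by (rule lipschitz_on_le) (simp add: Suc field_simps)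
qed

text \<open>Near \<open>x\<close> the partial sums are eventually a cutoff of large radius, which is
  1. If \<open>a\<close> is the least active index, then \<open>x\<close> is within
  \<open>2 ^ (a + 1)\<close> of \<open>p\<close>, where all weights beyond \<open>a + 1\<close>
  vanish.\<close>

lemma dyadic_support: "finite {k. dyadic p k x \<noteq> 0}" "card {k. dyadic p k x \<noteq> 0} \<le> 2"
  and sum_dyadic_support: "(\<Sum>k | dyadic p k x \<noteq> 0. dyadic p k x) = 1"
proof -
  obtain m where m: "dist x p \<le> 2 ^ m"
    using real_arch_pow[of 2 "dist x p"] by (auto intro: less_imp_le)
  have sub: "{k. dyadic p k x \<noteq> 0} \<subseteq> {..m}"
    using dyadic_inside[OF m] by (auto simp: not_le[symmetric])
  then show fin: "finite {k. dyadic p k x \<noteq> 0}" by (rule finite_subset) simp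
  have "(\<Sum>k | dyadic p k x \<noteq> 0. dyadic p k x) = (\<Sum>k\<le>m. dyadic p k x)"
    using sub by (intro sum.mono_neutral_left) auto
  also have "\<dots> = 1" by (simp add: sum_dyadic cutoff_eq_1 m)
  finally show "(\<Sum>k | dyadic p k x \<noteq> 0. dyadic p k x) = 1" .
  then have "\<exists>k. dyadic p k x \<noteq> 0"
    by (rule contrapos_pp) simp
  define a where "a = (LEAST k. dyadic p k x \<noteq> 0)"
  have a: "dyadic p a x \<noteq> 0" and a_le: "\<And>k. dyadic p k x \<noteq> 0 \<Longrightarrow> a \<le> k"
    unfolding a_def using LeastI_ex[OF \<open>\<exists>k. _\<close>] by (auto intro: Least_le)
  have "dist x p \<le> 2 ^ Suc a" using dyadic_outside[of a x p] a by fastforce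
  from dyadic_inside[OF this] a_le have "{k. dyadic p k x \<noteq> 0} \<subseteq> {a, Suc a}"
    by (smt (verit, best) insertCI le_antisym less_Suc_eq_le linorder_not_le mem_Collect_eq subsetI)
  from card_mono[OF _ this] show "card {k. dyadic p k x \<noteq> 0} \<le> 2"
    by (simp add: card_insert_if)
qed

text \<open>The constant is 4 times 7. At two points together at most four weights are active, and
  each product has constant \<open>K * (1 + (3 / 2 ^ k) * (2 * 2 ^ k)) = 7 * K\<close>, whatever
  \<open>k\<close> is.\<close>

lemma dyadic_sum_lipschitz:
  fixes h :: "nat \<Rightarrow> 'a::metric_space \<Rightarrow> real"
  assumes h: "\<And>k. K-lipschitz_on S (h k)" "\<And>k. h k p = 0" and "p \<in> S"
  shows "(28 * K)-lipschitz_on S (\<lambda>x. \<Sum>k | dyadic p k x \<noteq> 0. dyadic p k x * h k x)"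
proof -
  have K: "K \<ge> 0" using h(1) lipschitz_on_nonneg by blast
  have "(K * (1 + 3 / 2 ^ k * (2 * 2 ^ k)))-lipschitz_on S (\<lambda>x. dyadic p k x *\<^sub>R h k x)" for k
    by (rule lipschitz_on_cutoff_scaleR[OF h \<open>p \<in> S\<close> dyadic_lipschitz])
      (auto intro: abs_dyadic_le dyadic_outside)
  then have g: "\<bar>dyadic p k x * h k x - dyadic p k y * h k y\<bar> \<le> 7 * K * dist x y"
    if "x \<in> S" "y \<in> S" for k x y
    using that by (auto simp: lipschitz_on_real mult.commute)
  show ?thesis
    unfolding lipschitz_on_real
  proof (intro conjI ballI)
    fix x y assume xy: "x \<in> S" "y \<in> S"
    define U where "U = {k. dyadic p k x \<noteq> 0} \<union> {k. dyadic p k y \<noteq> 0}"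
    have fin: "finite U" unfolding U_def using dyadic_support by blast
    have card: "card U \<le> 4"
      unfolding U_def using card_Un_le[of "{k. dyadic p k x \<noteq> 0}" "{k. dyadic p k y \<noteq> 0}"]
        dyadic_support(2)[of p x] dyadic_support(2)[of p y] by linarith
    have ext: "(\<Sum>k | dyadic p k z \<noteq> 0. dyadic p k z * h k z) = (\<Sum>k\<in>U. dyadic p k z * h k z)"
      if "z = x \<or> z = y" for z
      using fin that by (intro sum.mono_neutral_left) (auto simp: U_def)
    have "\<bar>(\<Sum>k\<in>U. dyadic p k x * h k x) - (\<Sum>k\<in>U. dyadic p k y * h k y)\<bar>
        \<le> (\<Sum>k\<in>U. \<bar>dyadic p k x * h k x - dyadic p k y * h k y\<bar>)"
      unfolding sum_subtractf[symmetric] by (rule sum_abs)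
    also have "\<dots> \<le> of_nat (card U) * (7 * K * dist x y)"
      using g[OF xy] by (intro sum_bounded_above) auto
    also have "\<dots> \<le> 4 * (7 * K * dist x y)"
      using card K by (intro mult_right_mono) auto
    finally show "\<bar>(\<Sum>k | dyadic p k x \<noteq> 0. dyadic p k x * h k x)
        - (\<Sum>k | dyadic p k y \<noteq> 0. dyadic p k y * h k y)\<bar> \<le> 28 * K * dist x y"
      by (simp add: ext)
  qed (use K in simp)
qed

section \<open>Self-maps of a net\<close>

text \<open>A nearest net point need not exist, so \<nu> picks the net point within
  \<open>\<delta> / 2\<close>, unique by separation, and failing that any one within \<epsilon>;
  \<open>E\<close> covers both cases. \<nu> itself jumps, but after a map defined on the net the
  additive error \<open>2 * E\<close> is at most \<open>2 * E / \<delta>\<close> times the distance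
  of two distinct net points.\<close>

lemma net_rounding:
  assumes "net_in UNIV N"
  obtains E \<delta> and \<nu> :: "'a::metric_space \<Rightarrow> 'a" where "E \<ge> 0" "\<delta> > 0" "\<And>z. \<nu> z \<in> N"
    "\<And>z. dist z (\<nu> z) \<le> E" "\<And>x z. x \<in> N \<Longrightarrow> dist z x < \<delta> / 2 \<Longrightarrow> \<nu> z = x"
    "\<And>h L. L-lipschitz_on N h \<Longrightarrow> (L + 2 * E / \<delta>)-lipschitz_on N (\<lambda>x. \<nu> (h x))"
proof -
  obtain \<epsilon> \<delta> where eps: "\<epsilon> > 0" "\<And>x. \<exists>y\<in>N. dist x y \<le> \<epsilon>"
    and del: "\<delta> > 0" "\<And>x y. x \<in> N \<Longrightarrow> y \<in> N \<Longrightarrow> x \<noteq> y \<Longrightarrow> \<delta> \<le> dist x y"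
    using assms unfolding net_in_def by (metis UNIV_I)
  define E where "E = \<epsilon> + \<delta>"
  define close where "close = (\<lambda>z x. x \<in> N \<and> dist z x < \<delta> / 2)"
  define \<nu> where "\<nu> = (\<lambda>z. if \<exists>x. close z x then SOME x. close z x
    else SOME y. y \<in> N \<and> dist z y \<le> \<epsilon>)"
  have close_unique: "x = y" if "close z x" "close z y" for x y z
    using that del(2)[of x y] dist_triangle2[of x y z] unfolding close_def
    by (auto simp: dist_commute)
  have \<nu>_close: "\<nu> z = x" if "close z x" for x z
    using that close_unique someI[of "close z"] unfolding \<nu>_def by auto
  have \<nu>: "\<nu> z \<in> N \<and> dist z (\<nu> z) \<le> E" for z
  proof (cases "\<exists>x. close z x")
    case True
    then show ?thesis using \<nu>_close eps(1) del(1) unfolding close_def E_def by force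
  next
    case False
    then have "\<nu> z = (SOME y. y \<in> N \<and> dist z y \<le> \<epsilon>)"
      unfolding \<nu>_def by (rule if_not_P)
    moreover have "\<exists>y. y \<in> N \<and> dist z y \<le> \<epsilon>" using eps(2)[of z] by blast
    ultimately have "\<nu> z \<in> N \<and> dist z (\<nu> z) \<le> \<epsilon>" using someI_ex by metis
    then show ?thesis using del(1) by (simp add: E_def)
  qed
  have E: "E \<ge> 0" using eps del by (simp add: E_def)
  have lip: "(L + 2 * E / \<delta>)-lipschitz_on N (\<lambda>x. \<nu> (h x))" if h: "L-lipschitz_on N h" for h L
  proof (rule lipschitz_onI)
    fix x y assume xy: "x \<in> N" "y \<in> N"
    show "dist (\<nu> (h x)) (\<nu> (h y)) \<le> (L + 2 * E / \<delta>) * dist x y"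
    proof (cases "x = y")
      case False
      have "dist (\<nu> (h x)) (\<nu> (h y)) \<le> dist (h x) (h y) + 2 * E"
        using dist_triangle[of "\<nu> (h x)" "\<nu> (h y)" "h x"] dist_triangle[of "h x" "\<nu> (h y)" "h y"]
          \<nu>[of "h x"] \<nu>[of "h y"] by (simp add: dist_commute)
      also have "\<dots> \<le> L * dist x y + 2 * E / \<delta> * dist x y"
      proof (rule add_mono[OF lipschitz_onD[OF h xy]])
        have "2 * E / \<delta> * \<delta> \<le> 2 * E / \<delta> * dist x y"
          using del(2)[OF xy False] del(1) E by (intro mult_left_mono) auto
        then show "2 * E \<le> 2 * E / \<delta> * dist x y" using del(1) by simp
      qed
      finally show ?thesis by (simp add: distrib_right)
    qed simp
  next
    show "0 \<le> L + 2 * E / \<delta>"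
      using lipschitz_on_nonneg[OF h] E del(1) by simp
  qed
  show thesis
  proof (rule that[OF E del(1)])
    show "\<nu> z \<in> N" "dist z (\<nu> z) \<le> E" for z using \<nu> by blast+
    show "\<nu> z = x" if "x \<in> N" "dist z x < \<delta> / 2" for x z
      using \<nu>_close that by (simp add: close_def)
    show "(L + 2 * E / \<delta>)-lipschitz_on N (\<lambda>x. \<nu> (h x))" if "L-lipschitz_on N h" for h L
      using lip that .
  qed
qed

text \<open>
  The map \<open>\<phi> i\<close> rounds \<open>x \<mapsto> c i + \<mu> (x - p)\<close> to the net. If the dilation factor \<open>\<mu>\<close> is
  large, undoing the dilation moves the rounding error below \<open>\<delta> / 2\<close>, and a second rounding
  recovers \<open>x\<close>.
\<close>
lemma net_disjoint_copies:
  fixes N :: "'a::real_normed_vector set"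
  assumes net: "net_in UNIV N" and "p \<in> N" and v: "norm (v::'a) = 1"
  obtains \<phi> r :: "nat \<Rightarrow> 'a \<Rightarrow> 'a" and U :: "nat \<Rightarrow> 'a set" and K
  where "\<And>i x. \<phi> i x \<in> N" "\<And>i. K-lipschitz_on N (\<phi> i)"
    "\<And>i x. r i x \<in> N" "\<And>i. K-lipschitz_on N (r i)" "\<And>i x. x \<notin> U i \<Longrightarrow> r i x = p"
    "\<And>i x. x \<in> N \<Longrightarrow> dist x p \<le> 2 * 2 ^ i \<Longrightarrow> \<phi> i x \<in> U i \<and> r i (\<phi> i x) = x"
    "\<And>i. p \<notin> U i" "\<And>i j x. x \<in> U i \<Longrightarrow> x \<in> U j \<Longrightarrow> i = j"
proof (rule net_rounding[OF net])
  fix E \<delta> \<nu>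
  assume E: "E \<ge> 0" and \<delta>: "\<delta> > 0" and \<nu>: "\<And>z. \<nu> z \<in> N"
    "\<And>z. dist z (\<nu> z) \<le> E" "\<And>x z. x \<in> N \<Longrightarrow> dist z x < \<delta> / 2 \<Longrightarrow> \<nu> z = x"
    "\<And>h L. L-lipschitz_on N h \<Longrightarrow> (L + 2 * E / \<delta>)-lipschitz_on N (\<lambda>x. \<nu> (h x))"
  \<comment> \<open>Chosen to make \<open>E / \<mu> < \<delta> / 2\<close>: indeed
    \<open>\<delta> / 2 * \<mu> = \<delta> / 2 + E\<close>.\<close>
  define \<mu> where "\<mu> = 1 + 2 * E / \<delta>"
  have \<mu>: "\<mu> \<ge> 1" using E \<delta> by (simp add: \<mu>_def)
  have \<mu>_small: "E / \<mu> < \<delta> / 2" "E / \<mu> \<le> E"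
  proof -
    have "E < \<delta> / 2 * \<mu>" using \<delta> by (simp add: \<mu>_def field_simps)
    then show "E / \<mu> < \<delta> / 2" using \<mu> by (simp add: field_simps)
    show "E / \<mu> \<le> E" using \<mu> E mult_left_mono[of 1 \<mu> E] by (simp add: field_simps)
  qed
  \<comment> \<open>Room for a vector of length \<open>2 * 2 ^ i\<close> plus a rounding error,
    which after undoing the dilation is at most \<open>E\<close>, hence at most
    \<open>E * 2 ^ i\<close>.\<close>
  define \<rho> where "\<rho> = (\<lambda>i::nat. (2 + E) * 2 ^ i)"
  have \<rho>: "\<rho> i > 0" for i using E by (simp add: \<rho>_def)
  define D where "D = 2 * \<mu> * (2 + E)"
  have D: "D > 0" using \<mu> E by (simp add: D_def)
  have \<rho>_D: "2 * \<mu> * \<rho> i = D * 2 ^ i" for i by (simp add: \<rho>_def D_def)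
  \<comment> \<open>The ball \<open>U i\<close> will have radius
    \<open>2 * \<mu> * \<rho> i = D * 2 ^ i\<close>. Centres at distances
    \<open>D * 4 ^ (i + 1)\<close> from \<open>p\<close> on one ray are at least as far apart as the
    two radii together, and the open balls miss \<open>p\<close>.\<close>
  define t where "t = (\<lambda>i::nat. D * 4 ^ Suc i)"
  define c where "c = (\<lambda>i. p + t i *\<^sub>R v)"
  define U where "U = (\<lambda>i. {z. dist z (c i) < 2 * \<mu> * \<rho> i})"
  \<comment> \<open>The identity up to radius \<rho> and 0 beyond \<open>2 * \<rho>\<close>. It lets
    \<open>r i\<close> undo \<open>\<phi> i\<close> on the inner ball and yet be constant outside
    \<open>U i\<close>. Its Lipschitz constant \<open>1 + (1 / \<rho>) * (2 * \<rho>) = 3\<close> is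
    independent of \<rho>.\<close>
  define \<tau> where "\<tau> = (\<lambda>\<rho> u. cutoff 0 \<rho> u *\<^sub>R (u::'a))"
  define r where "r = (\<lambda>i z. \<nu> (p + \<tau> (\<rho> i) ((1 / \<mu>) *\<^sub>R (z - c i))))"
  define \<phi> where "\<phi> = (\<lambda>i x. \<nu> (c i + \<mu> *\<^sub>R (x - p)))"
  \<comment> \<open>Dominates both \<open>\<mu> + 2 * E / \<delta>\<close> for
    \<open>\<phi> i\<close> and \<open>3 + 2 * E / \<delta>\<close> for \<open>r i\<close>.\<close>
  define K where "K = \<mu> + 3 + 2 * E / \<delta>"
  have pow: "(2::real) ^ i \<le> 4 ^ i" for i by (intro power_mono) auto
  have sep: "D * 2 ^ i + D * 2 ^ j \<le> dist (c i) (c j)" if "j < i" for i j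
  proof -
    have "(4::real) ^ Suc j \<le> 4 ^ i" using that by (intro power_increasing) auto
    then have "2 * 2 ^ i + 4 ^ Suc j \<le> (4::real) ^ Suc i"
      using pow[of i] zero_less_power[of "4::real" i] unfolding power_Suc by linarith
    moreover have "(2::real) ^ j \<le> 2 ^ i" using that by (intro power_increasing) auto
    ultimately have "(2::real) ^ i + 2 ^ j \<le> 4 ^ Suc i - 4 ^ Suc j" by linarith
    then have "D * (2 ^ i + 2 ^ j) \<le> D * (4 ^ Suc i - 4 ^ Suc j)"
      using less_imp_le[OF D] by (intro mult_left_mono)
    also have "\<dots> \<le> \<bar>t i - t j\<bar>" by (simp add: t_def right_diff_distrib)
    also have "\<dots> = dist (c i) (c j)"
      using v by (simp add: c_def dist_norm flip: scaleR_diff_left)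
    finally show ?thesis by (simp add: distrib_left)
  qed
  have disj: "\<not> (x \<in> U i \<and> x \<in> U j)" if "j < i" for i j x
    using sep[OF that] dist_triangle3[of "c i" "c j" x] by (auto simp: U_def \<rho>_D)
  have "3-lipschitz_on UNIV (\<tau> (\<rho> i))" for i
  proof -
    have "(1 * (1 + 1 / \<rho> i * (2 * \<rho> i)))-lipschitz_on UNIV (\<lambda>u::'a. cutoff 0 (\<rho> i) u *\<^sub>R u)"
      using \<rho>[of i]
      by (intro lipschitz_on_cutoff_scaleR[where p = 0] cutoff_lipschitz)
        (auto simp: lipschitz_on_def cutoff_bounds intro: cutoff_eq_0)
    then show ?thesis using \<rho>[of i] by (simp add: \<tau>_def)
  qed
  then have \<tau>_lip: "dist (\<tau> (\<rho> i) u) (\<tau> (\<rho> i) u') \<le> 3 * dist u u'" for i u u'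
    by (auto dest: lipschitz_onD)
  show thesis
  proof (rule that[of \<phi> K r U])
    show "\<phi> i x \<in> N" "r i x \<in> N" for i x by (simp_all add: \<phi>_def r_def \<nu>(1))
    have "\<mu>-lipschitz_on N (\<lambda>x. c i + \<mu> *\<^sub>R (x - p))" for i
      using \<mu> by (intro lipschitz_onI) (auto simp: dist_norm simp flip: scaleR_diff_right)
    from \<nu>(4)[OF this] show "K-lipschitz_on N (\<phi> i)" for i
      unfolding \<phi>_def by (rule lipschitz_on_le) (simp add: K_def)
    have "3-lipschitz_on N (\<lambda>z. p + \<tau> (\<rho> i) ((1 / \<mu>) *\<^sub>R (z - c i)))" for i
    proof (rule lipschitz_onI)
      fix z z'
      have "dist (p + \<tau> (\<rho> i) ((1 / \<mu>) *\<^sub>R (z - c i))) (p + \<tau> (\<rho> i) ((1 / \<mu>) *\<^sub>R (z' - c i)))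
          \<le> 3 * dist ((1 / \<mu>) *\<^sub>R (z - c i)) ((1 / \<mu>) *\<^sub>R (z' - c i))"
        using \<tau>_lip by simp
      also have "\<dots> = 3 * (dist z z' / \<mu>)"
        using \<mu> by (simp add: dist_norm flip: scaleR_diff_right)
      also have "\<dots> \<le> 3 * dist z z'"
        using \<mu> mult_left_mono[of 1 \<mu> "dist z z'"] by (simp add: field_simps)
      finally show "dist (p + \<tau> (\<rho> i) ((1 / \<mu>) *\<^sub>R (z - c i)))
          (p + \<tau> (\<rho> i) ((1 / \<mu>) *\<^sub>R (z' - c i))) \<le> 3 * dist z z'" .
    qed simp
    from \<nu>(4)[OF this] show "K-lipschitz_on N (r i)" for i
      unfolding r_def by (rule lipschitz_on_le) (use \<mu> in \<open>simp add: K_def\<close>)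
    show "r i x = p" if "x \<notin> U i" for i x
    proof -
      have "2 * \<rho> i \<le> dist ((1 / \<mu>) *\<^sub>R (x - c i)) 0"
      proof -
        have "2 * \<rho> i * \<mu> \<le> norm (x - c i)"
          using that by (simp add: U_def dist_norm algebra_simps)
        then have "2 * \<rho> i \<le> norm (x - c i) / \<mu>"
          using \<mu> by (simp add: pos_le_divide_eq)
        then show ?thesis using \<mu> by simp
      qed
      then have "\<tau> (\<rho> i) ((1 / \<mu>) *\<^sub>R (x - c i)) = 0"
        using \<rho>[of i] by (simp add: \<tau>_def cutoff_eq_0)
      then show ?thesis using \<nu>(3)[OF \<open>p \<in> N\<close>, of p] \<delta> by (simp add: r_def)
    qed
    show "p \<notin> U i" for i
    proof -
      have "(2::real) ^ i \<le> 4 ^ Suc i"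
        using pow[of i] zero_less_power[of "4::real" i] unfolding power_Suc by linarith
      then have "D * 2 ^ i \<le> D * 4 ^ Suc i"
        using less_imp_le[OF D] by (intro mult_left_mono)
      then show ?thesis using v D by (simp add: U_def \<rho>_D c_def t_def dist_norm)
    qed
    show "i = j" if "x \<in> U i" "x \<in> U j" for i j x
      using disj[of i j x] disj[of j i x] that by (meson linorder_neqE_nat)
    show "\<phi> i x \<in> U i \<and> r i (\<phi> i x) = x" if x: "x \<in> N" "dist x p \<le> 2 * 2 ^ i" for i x
    proof -
      define e where "e = \<phi> i x - (c i + \<mu> *\<^sub>R (x - p))"
      have e: "norm e \<le> E"
        using \<nu>(2)[of "c i + \<mu> *\<^sub>R (x - p)"] by (simp add: e_def \<phi>_def dist_norm norm_minus_commute)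
      \<comment> \<open>The vector that \<tau> receives in \<open>r i (\<phi> i x)\<close>. It is
        \<open>x - p\<close> up to \<open>e / \<mu>\<close>: short enough for \<tau> to fix it, and
        close enough for the second rounding to return \<open>x\<close>.\<close>
      define u where "u = (1 / \<mu>) *\<^sub>R (\<phi> i x - c i)"
      have u: "u = (x - p) + (1 / \<mu>) *\<^sub>R e"
        using \<mu> by (simp add: u_def e_def algebra_simps)
      have e': "norm ((1 / \<mu>) *\<^sub>R e) \<le> E / \<mu>"
        using e \<mu> by (simp add: divide_right_mono)
      have "norm u \<le> norm (x - p) + norm ((1 / \<mu>) *\<^sub>R e)"
        unfolding u by (rule norm_triangle_ineq)
      also have "\<dots> \<le> 2 * 2 ^ i + E * 2 ^ i"
      proof (rule add_mono)
        show "norm (x - p) \<le> 2 * 2 ^ i" using x(2) by (simp add: dist_norm)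
        show "norm ((1 / \<mu>) *\<^sub>R e) \<le> E * 2 ^ i"
          using e' \<mu>_small(2) mult_left_mono[of 1 "2 ^ i" E] E by simp
      qed
      finally have norm_u: "norm u \<le> \<rho> i" by (simp add: \<rho>_def distrib_right)
      have "norm u = dist (\<phi> i x) (c i) / \<mu>"
        using \<mu> by (simp add: u_def dist_norm)
      then have "dist (\<phi> i x) (c i) \<le> \<mu> * \<rho> i"
        using norm_u \<mu> by (simp add: pos_divide_le_eq mult.commute)
      also have "\<dots> < 2 * \<mu> * \<rho> i" using \<mu> \<rho>[of i] by simp
      finally have "\<phi> i x \<in> U i" by (simp add: U_def)
      moreover have "\<tau> (\<rho> i) u = u"
        using norm_u \<rho>[of i] by (simp add: \<tau>_def cutoff_eq_1 dist_norm)
      then have "r i (\<phi> i x) = \<nu> (x + (1 / \<mu>) *\<^sub>R e)"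
        by (simp add: r_def u_def[symmetric]) (simp add: u)
      moreover have "dist (x + (1 / \<mu>) *\<^sub>R e) x < \<delta> / 2"
        using le_less_trans[OF e' \<mu>_small(1)] by (simp add: dist_norm)
      ultimately show ?thesis using \<nu>(3)[OF x(1)] by simp
    qed
  qed
qed

text \<open>
  Copy number \<open>prod_encode (n, k)\<close> receives the dyadic annulus \<open>k\<close> of the \<open>n\<close>-th summand.
\<close>
lemma lipschitz_free_isomorphic_l1_sum:
  fixes \<phi> r :: "nat \<Rightarrow> 'a::metric_space \<Rightarrow> 'a" and U :: "nat \<Rightarrow> 'a set"
  assumes p: "p \<in> N" and \<phi>_mem: "\<And>i x. \<phi> i x \<in> N" and \<phi>_lip: "\<And>i. K-lipschitz_on N (\<phi> i)"
    and r_mem: "\<And>i x. r i x \<in> N" and r_lip: "\<And>i. K-lipschitz_on N (r i)"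
    and r_out: "\<And>i x. x \<notin> U i \<Longrightarrow> r i x = p"
    and r\<phi>: "\<And>i x. x \<in> N \<Longrightarrow> dist x p \<le> 2 * 2 ^ i \<Longrightarrow> \<phi> i x \<in> U i \<and> r i (\<phi> i x) = x"
    and p_out: "\<And>i. p \<notin> U i" and disj: "\<And>i j x. x \<in> U i \<Longrightarrow> x \<in> U j \<Longrightarrow> i = j"
  shows "linearly_isomorphic (lipschitz_free N p) (l1_sum (lipschitz_free N p))"
proof -
  define V where "V = Lip0 N p"
  interpret V: seminormed_space V unfolding V_def by (rule seminormed_Lip0)
  interpret D: seminormed_space "dual V" by (rule V.seminormed_dual)
  define S where "S = evaluation N p ` N"
  have K: "K \<ge> 0" using \<phi>_lip lipschitz_on_nonneg by blast
  have V_p: "f p = 0" and V_out: "x \<notin> N \<Longrightarrow> f x = 0" if "f \<in> pts V" for f x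
    using that by (auto simp: V_def pts_Lip0)
  have S: "S \<subseteq> pts (dual V)"
    using evaluation_in_dual[OF p] by (auto simp: S_def V_def)
  have S_span: "evaluation N p x \<in> span S" if "x \<in> N" for x
    using that by (auto simp: S_def intro: span_base)
  \<comment> \<open>The balls of the copies are disjoint, so the choice of \<open>k\<close> is
    forced and the retractions of all copies of summand \<open>n\<close> form one map, with value
    \<open>p\<close> elsewhere.\<close>
  define q where "q = (\<lambda>n z. if \<exists>k. z \<in> U (prod_encode (n, k))
    then r (prod_encode (n, SOME k. z \<in> U (prod_encode (n, k)))) z else p)"
  have q_in: "q n z = r (prod_encode (n, k)) z" if "z \<in> U (prod_encode (n, k))" for n k z
  proof -
    have "z \<in> U (prod_encode (n, SOME k. z \<in> U (prod_encode (n, k))))"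
      using that by (rule someI)
    from disj[OF this that] show ?thesis
      using that by (auto simp: q_def)
  qed
  have q_out: "q m z = p" if "z \<in> U (prod_encode (n, k))" "m \<noteq> n" for m n k z
  proof -
    have "z \<notin> U (prod_encode (m, l))" for l
      using disj[OF that(1), of "prod_encode (m, l)"] that(2) by auto
    then show ?thesis by (simp add: q_def)
  qed
  have q_p: "q n z = p" if "\<And>i. z \<notin> U i" for n z
    using that by (simp add: q_def)
  have q_mem: "q n z \<in> N" for n z
    using r_mem p by (simp add: q_def)
  define A where "A = (\<lambda>n (f::'a \<Rightarrow> real) x. if x \<in> N then f (q n x) else 0)"
  \<comment> \<open>Subtracting the value at \<open>p\<close> makes \<open>b n k f\<close> vanish
    there, as the product with a weight requires. On functions \<open>A m f\<close> the subtracted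
    value is 0, because the retraction sends the copy of \<open>p\<close> back to
    \<open>p\<close>.\<close>
  define b where "b = (\<lambda>n k (f::'a \<Rightarrow> real) x.
    f (\<phi> (prod_encode (n, k)) x) - f (\<phi> (prod_encode (n, k)) p))"
  define B where "B = (\<lambda>n (f::'a \<Rightarrow> real) x.
    if x \<in> N then \<Sum>k | dyadic p k x \<noteq> 0. dyadic p k x * b n k f x else 0)"
  have f_comp: "(L * K)-lipschitz_on N (\<lambda>x. f (h x))"
    if "L-lipschitz_on N f" "K-lipschitz_on N h" "\<And>x. h x \<in> N" for f :: "'a \<Rightarrow> real" and h L
  proof -
    have "L-lipschitz_on (h ` N) f" using that(1,3) by (auto intro: lipschitz_on_subset)
    from lipschitz_on_compose2[OF that(2) this] show ?thesis .
  qed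
  \<comment> \<open>Regrouped by copies instead of summands: on \<open>U i\<close> only the summand
    that owns copy \<open>i\<close> contributes, and outside all balls every \<open>f n\<close> is
    evaluated at \<open>p\<close>. The pieces \<open>g i\<close> therefore have disjoint supports,
    and the bound does not grow with the number of summands.\<close>
  have A_sum: "(2 * (L * K))-lipschitz_on N (\<Sum>n\<in>I. A n (f n))"
    if f: "\<And>n. f n \<in> pts V" "\<And>n. L-lipschitz_on N (f n)" and I: "finite I" for f L I
  proof (rule lipschitz_on_disjoint_supports)
    define g where "g = (\<lambda>i x. if fst (prod_decode i) \<in> I then f (fst (prod_decode i)) (r i x) else 0)"
    have L: "L \<ge> 0" using f(2) lipschitz_on_nonneg by blast
    show "(L * K)-lipschitz_on N (g i)" for i
    proof (cases "fst (prod_decode i) \<in> I")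
      case True
      then show ?thesis
        using f_comp[OF f(2) r_lip r_mem] by (simp add: g_def)
    next
      case False
      then show ?thesis
        using L K by (simp add: g_def lipschitz_on_real)
    qed
    fix x assume x: "x \<in> N"
    have sum_apply: "(\<Sum>n\<in>I. A n (f n)) x = (\<Sum>n\<in>I. f n (q n x))"
      using I by (induction I rule: finite_induct) (simp_all add: A_def x)
    have g_out: "g i x = 0" if "x \<notin> U i" for i
      using that f(1) by (simp add: g_def r_out V_p)
    show "\<exists>i. (\<Sum>n\<in>I. A n (f n)) x = g i x \<and> (\<forall>j. j \<noteq> i \<longrightarrow> g j x = 0)"
    proof (cases "\<exists>i. x \<in> U i")
      case True
      then obtain i where i: "x \<in> U i" by blast
      obtain n k where nk: "prod_decode i = (n, k)" by (cases "prod_decode i")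
      then have i_eq: "i = prod_encode (n, k)" by (metis prod_decode_inverse)
      have "f m (q m x) = (if m = n then f n (r i x) else 0)" for m
        using q_in[of x n k] q_out[of x n k m] i f(1) by (auto simp: i_eq V_p)
      then have "(\<Sum>n\<in>I. f n (q n x)) = g i x"
        using I nk by (simp add: g_def)
      then show ?thesis
        using disj[OF i] g_out sum_apply by (intro exI[of _ i]) auto
    next
      case False
      then have "(\<Sum>n\<in>I. f n (q n x)) = 0"
        using f(1) by (intro sum.neutral) (simp add: q_p V_p)
      then show ?thesis
        using False g_out sum_apply by auto
    qed
  qed
  have A_lip: "(2 * K * L)-lipschitz_on N (A n f)" if "f \<in> pts V" "L-lipschitz_on N f" for n f L
    using A_sum[of "\<lambda>_. f" L "{n}"] that by (simp add: ac_simps)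
  have A: "bounded_linear_map V V (A n)" for n
    unfolding V_def
  proof (rule bounded_linear_map_Lip0I)
    show "A n f p = 0" if "f \<in> pts (Lip0 N p)" for f
      using that q_p p_out by (simp add: A_def pts_Lip0)
  qed (use A_lip in \<open>auto simp: A_def V_def scaleR_fun_def\<close>)
  have b_lip: "(L * K)-lipschitz_on N (b n k f)" if "L-lipschitz_on N f" for n k f L
    using f_comp[OF that \<phi>_lip \<phi>_mem] by (simp add: b_def lipschitz_on_real)
  have B_lip: "(28 * K * L)-lipschitz_on N (B n f)" if "L-lipschitz_on N f" for n f L
  proof -
    have "(28 * (L * K))-lipschitz_on N (\<lambda>x. \<Sum>k | dyadic p k x \<noteq> 0. dyadic p k x * b n k f x)"
      by (rule dyadic_sum_lipschitz[OF b_lip[OF that] _ p]) (simp add: b_def)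
    then show ?thesis
      by (simp add: lipschitz_on_real B_def ac_simps)
  qed
  have b_lin: "b n k (f + g) x = b n k f x + b n k g x" "b n k (c *\<^sub>R f) x = c * b n k f x"
    for n k f g c x
    by (simp_all add: b_def scaleR_fun_def right_diff_distrib)
  have B_lin: "B n (f + g) x = B n f x + B n g x" "B n (c *\<^sub>R f) x = c * B n f x" for n f g c x
    by (simp_all add: B_def b_lin distrib_left sum.distrib sum_distrib_left mult.left_commute)
  have B_p: "B n f p = 0" and B_out: "x \<notin> N \<Longrightarrow> B n f x = 0" for n f x
    by (simp_all add: B_def b_def)
  have B_map: "bounded_linear_map V V (B n)"
    and B_le: "f \<in> pts V \<Longrightarrow> nrm V (B n f) \<le> 28 * K * nrm V f" for n f
    unfolding V_def
    by (rule bounded_linear_map_Lip0I(1)[where C = "28 * K"]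
        bounded_linear_map_Lip0I(2)[where A = "B n"];
      use B_lin B_lip B_p B_out in simp)+
  have BA: "B n (A m f) = (if n = m then f else 0)" if f: "f \<in> pts V" for n m f
  proof
    fix x
    show "B n (A m f) x = (if n = m then f else 0) x"
    proof (cases "x \<in> N")
      case True
      have b_eq: "b n k (A m f) x = (if n = m then f x else 0)" if k: "dyadic p k x \<noteq> 0" for k
      proof -
        define i where "i = prod_encode (n, k)"
        have "dist x p \<le> 2 * 2 ^ k" using dyadic_outside[of k x p] k by fastforce
        \<comment> \<open>\<open>prod_encode\<close> dominates its second component, so the ball
          that \<open>\<phi> i\<close> copies faithfully contains annulus \<open>k\<close>.\<close>
        moreover have "(2::real) ^ k \<le> 2 ^ i"
          unfolding i_def by (intro power_increasing le_prod_encode_2) simp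
        ultimately have "dist x p \<le> 2 * 2 ^ i" by linarith
        then have x: "\<phi> i x \<in> U i" "r i (\<phi> i x) = x"
          using r\<phi>[OF True, of i] by auto
        have p': "\<phi> i p \<in> U i" "r i (\<phi> i p) = p"
          using r\<phi>[OF p, of i] by auto
        have eval: "A m f (\<phi> i z) = (if n = m then f z else 0)"
          if "\<phi> i z \<in> U i" "r i (\<phi> i z) = z" for z
          using that q_in[of "\<phi> i z" n k] q_out[of "\<phi> i z" n k m] V_p[OF f] \<phi>_mem[of i z]
          by (auto simp: A_def i_def)
        show ?thesis
          using eval[OF x] eval[OF p'] V_p[OF f] by (simp add: b_def i_def)
      qed
      have "B n (A m f) x = (\<Sum>k | dyadic p k x \<noteq> 0. dyadic p k x * (if n = m then f x else 0))"
        using True b_eq by (simp add: B_def)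
      also have "\<dots> = (if n = m then f x else 0)"
        unfolding sum_distrib_right[symmetric] by (simp add: sum_dyadic_support)
      finally show ?thesis by simp
    next
      case False
      then show ?thesis using V_out[OF f] by (simp add: B_out)
    qed
  qed
  have "linearly_isomorphic (closed_span (dual V) S) (l1_sum (closed_span (dual V) S))"
  proof (rule closed_span_dual_isomorphic_l1_sum[OF V.seminormed_space_axioms S _ A B_map])
    \<comment> \<open>\<open>28 * K\<close> comes from \<open>B_lip\<close>; it also exceeds the
      \<open>2 * K\<close> of \<open>A_sum\<close>.\<close>
    show "0 \<le> 28 * K" using K by simp
    show "nrm V (B n f) \<le> 28 * K * nrm V f" if "f \<in> pts V" for n f
      by (rule B_le[OF that])
    show "nrm V (\<Sum>n<m. A n (f n)) \<le> 28 * K"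
      if f: "\<And>n. f n \<in> pts V" "\<And>n. nrm V (f n) \<le> 1" for m f
    proof -
      have "1-lipschitz_on N (f n)" for n
        using Lip0_lipschitz[of "f n" N p] f by (auto simp: V_def intro: lipschitz_on_le)
      then have "(2 * (1 * K))-lipschitz_on N (\<Sum>n<m. A n (f n))"
        by (intro A_sum f(1)) auto
      then have "(28 * K)-lipschitz_on N (\<Sum>n<m. A n (f n))"
        by (rule lipschitz_on_le) (use K in simp)
      then show ?thesis unfolding V_def by (rule Lip0_nrm_le)
    qed
    show "B n (A m f) = (if n = m then f else 0)" if "f \<in> pts V" for n m f
      by (rule BA[OF that])
    fix n a assume "a \<in> S"
    then obtain x where x: "x \<in> N" and a: "a = evaluation N p x"
      by (auto simp: S_def)
    have "pullback V (A n) a = evaluation N p (q n x)"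
      using bounded_linear_mapD(1)[OF A, of _ n] x
      by (auto simp: pullback_def a evaluation_def V_def A_def fun_eq_iff)
    then have "pullback V (A n) a \<in> span S"
      using S_span q_mem by simp
    then show "pullback V (A n) a \<in> pts (closed_span (dual V) S)"
      using D.span_subset_closed_span[OF S] by blast
    \<comment> \<open>Finitely many weights are active at \<open>x\<close>, so the adjoint of
      \<open>B n\<close> sends an evaluation to a finite combination of differences of evaluations,
      a member of the span itself.\<close>
    define y where "y = (\<Sum>k | dyadic p k x \<noteq> 0. dyadic p k x *\<^sub>R
      (evaluation N p (\<phi> (prod_encode (n, k)) x) - evaluation N p (\<phi> (prod_encode (n, k)) p)))"
    have sum_apply: "(\<Sum>k\<in>I. g k) f = (\<Sum>k\<in>I. g k f)"
      for I :: "nat set" and g :: "nat \<Rightarrow> ('a \<Rightarrow> real) \<Rightarrow> real" and f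
      by (induction I rule: infinite_finite_induct) auto
    have "pullback V (B n) a f = y f" for f
    proof (cases "f \<in> pts V")
      case True
      then show ?thesis
        using bounded_linear_mapD(1)[OF B_map True, of n] x
        by (simp add: y_def sum_apply pullback_def a evaluation_def V_def B_def b_def scaleR_fun_def)
    next
      case False
      then show ?thesis
        by (simp add: y_def sum_apply pullback_def evaluation_def V_def scaleR_fun_def)
    qed
    then have "pullback V (B n) a = y" by blast
    moreover have "y \<in> span S"
      unfolding y_def by (intro span_sum span_scale span_diff S_span \<phi>_mem)
    ultimately show "pullback V (B n) a \<in> pts (closed_span (dual V) S)"
      using D.span_subset_closed_span[OF S] by blast
  qed
  then show ?thesis
    by (simp add: lipschitz_free_def V_def S_def)
qed

theorem theorem3p6:
  fixes N :: "'a::banach set" and p :: 'a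
  assumes "net_in UNIV N" and "p \<in> N"
  shows "linearly_isomorphic (lipschitz_free N p) (l1_sum (lipschitz_free N p))"
proof (cases "\<exists>v::'a. norm v = 1")
  case True
  then obtain v :: 'a where "norm v = 1" by blast
  show ?thesis
  proof (rule net_disjoint_copies[OF assms \<open>norm v = 1\<close>])
    fix \<phi> r :: "nat \<Rightarrow> 'a \<Rightarrow> 'a" and U :: "nat \<Rightarrow> 'a set" and K
    assume "\<And>i x. \<phi> i x \<in> N" "\<And>i. K-lipschitz_on N (\<phi> i)"
      "\<And>i x. r i x \<in> N" "\<And>i. K-lipschitz_on N (r i)" "\<And>i x. x \<notin> U i \<Longrightarrow> r i x = p"
      "\<And>i x. x \<in> N \<Longrightarrow> dist x p \<le> 2 * 2 ^ i \<Longrightarrow> \<phi> i x \<in> U i \<and> r i (\<phi> i x) = x"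
      "\<And>i. p \<notin> U i" "\<And>i j x. x \<in> U i \<Longrightarrow> x \<in> U j \<Longrightarrow> i = j"
    from lipschitz_free_isomorphic_l1_sum[OF assms(2) this] show ?thesis .
  qed
next
  case False
  \<comment> \<open>A nonzero vector could be normalised. So the space is a single point,
    \<open>Lip0 N p\<close> contains only 0, and zero operators satisfy the requirements of the
    factorisation theorem.\<close>
  have "x = 0" for x :: 'a
    using False norm_sgn[of x] by presburger
  then have N: "x = p" for x
    by metis
  have lip: "f = 0" if "f \<in> pts (Lip0 N p)" for f
  proof
    show "f x = 0 x" for x
      using that N[of x] by (simp add: pts_Lip0)
  qed
  have pb: "pullback (Lip0 N p) (\<lambda>_. 0) a = 0" if "a \<in> pts (dual (Lip0 N p))" for a
    using dualD(2)[OF that, of 0 0] seminormed_space.pts_closed(1)[OF seminormed_Lip0, of N p]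
    by (auto simp: pullback_def fun_eq_iff)
  have ev: "evaluation N p ` N \<subseteq> pts (dual (Lip0 N p))"
    using evaluation_in_dual[OF assms(2)] by blast
  note D = seminormed_space.seminormed_dual[OF seminormed_Lip0, of N p]
  have 0: "0 \<in> pts (closed_span (dual (Lip0 N p)) (evaluation N p ` N))"
    using seminormed_space.pts_closed(1)[OF seminormed_space.seminormed_closed_span[OF D ev]] .
  have z: "bounded_linear_map (Lip0 N p) (Lip0 N p) (\<lambda>_. 0)"
    by (rule bounded_linear_mapI[where K = 0])
      (auto simp: seminormed_space.pts_closed(1)[OF seminormed_Lip0] seminormed_space.nrm_zero[OF seminormed_Lip0])
  show ?thesis
    unfolding lipschitz_free_def
    by (rule closed_span_dual_isomorphic_l1_sum[where A = "\<lambda>_ _. 0" and B = "\<lambda>_ _. 0" and C = 0,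
          OF seminormed_Lip0 ev _ z z])
      (use pb ev 0 in \<open>auto simp: seminormed_space.nrm_zero[OF seminormed_Lip0] dest: lip\<close>)
qed

end
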